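(* Let $0<s<1$ and let $a<b$ be two real numbers. Then \[ \Lambda_{s,2}\int_a^b|u|^2\left[\frac1{t-a}+\frac1{b-t}\right]^{2s}dt\le[u]^2_{W^{s,2}(\mathbb{R})},\qquad\text{for every }u\in\widetilde W^{s,2}_0((a,b)). \] In particular, $\mathfrak{h}_{s,2}((a,b))=\Lambda_{s,2}$, and such a constant is not attained, i.e. there is no $u\in\widetilde W^{s,2}_0((a,b))$ with $\int_a^b|u|^2 d_{(a,b)}^{-2s}\,dt=1$ and $[u]^2_{W^{s,2}(\mathbb{R})}=\mathfrak{h}_{s,2}((a,b))$.
   Context: $[u]_{W^{s,2}(\mathbb{R})}=\left(\iint_{\mathbb{R}\times\mathbb{R}}\frac{|u(x)-u(y)|^2}{|x-y|^{1+2s}}dx\,dy\right)^{1/2}$; $W^{s,2}(\mathbb{R})$ is the space of $u\in L^2(\mathbb{R})$ with $[u]_{W^{s,2}(\mathbb{R})}<\infty$, normed by $\|u\|_{L^2}+[u]_{W^{s,2}(\mathbb{R})}$; $\widetilde W^{s,2}_0((a,b))$ is the closure of $C^\infty_0((a,b))$ (extended by $0$) in $W^{s,2}(\mathbb{R})$. $d_{(a,b)}(t)=\min\{t-a,b-t\}$ and \[ \mathfrak{h}_{s,2}((a,b))=\inf_{u\in C^\infty_0((a,b))}\left\{[u]^2_{W^{s,2}(\mathbb{R})}:\int_a^b\frac{|u|^2}{d_{(a,b)}^{2s}}dt=1\right\}, \] which equals the same infimum over $\widetilde W^{s,2}_0((a,b))$. The constant is \[ \Lambda_{s,2}=2\int_0^1\frac{\left|1-t^{\frac{2s-1}{2}}\right|^2}{(1-t)^{1+2s}}\,dt+\frac1s.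 \] *)

theory Defs
  imports "HOL-Analysis.Analysis"
begin

definition ennreal_sqrt :: "ennreal \<Rightarrow> ennreal" where
  "ennreal_sqrt x = (if x = \<infinity> then \<infinity> else ennreal (sqrt (enn2real x)))"

definition L2_norm :: "(real \<Rightarrow> real) \<Rightarrow> ennreal" where
  "L2_norm u = ennreal_sqrt (\<integral>\<^sup>+ x. ennreal (\<bar>u x\<bar>\<^sup>2) \<partial>lebesgue)"

(* The double integral is taken over the plane with its Lebesgue measure;
   on the diagonal the quotient is 0 / 0 = 0. *)
definition gagliardo :: "real \<Rightarrow> (real \<Rightarrow> real) \<Rightarrow> ennreal" where
  "gagliardo s u = ennreal_sqrt
     (\<integral>\<^sup>+ (x, y). ennreal (\<bar>u x - u y\<bar>\<^sup>2 / \<bar>x - y\<bar> powr (1 + 2 * s))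
        \<partial>(lebesgue :: (real \<times> real) measure))"

(* Functions are not identified when equal almost everywhere. *)
definition W_space :: "real \<Rightarrow> (real \<Rightarrow> real) set" where
  "W_space s = {u \<in> borel_measurable lebesgue. L2_norm u < \<infinity> \<and> gagliardo s u < \<infinity>}"

definition W_norm :: "real \<Rightarrow> (real \<Rightarrow> real) \<Rightarrow> ennreal" where
  "W_norm s u = L2_norm u + gagliardo s u"

definition test_functions :: "real \<Rightarrow> real \<Rightarrow> (real \<Rightarrow> real) set" where
  "test_functions a b = {\<phi>.
     (\<forall>n x. (deriv ^^ n) \<phi> field_differentiable at x) \<and>
     compact (closure {x. \<phi> x \<noteq> 0}) \<and> closure {x. \<phi> x \<noteq> 0} \<subseteq> {a<..<b}}"

definition W_tilde :: "real \<Rightarrow> real \<Rightarrow> real \<Rightarrow> (real \<Rightarrow> real) set" where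
  "W_tilde s a b =
     {u \<in> W_space s. \<forall>\<epsilon>>0. \<exists>\<phi>\<in>test_functions a b. W_norm s (\<lambda>x. u x - \<phi> x) < \<epsilon>}"

definition bdist :: "real \<Rightarrow> real \<Rightarrow> real \<Rightarrow> real" where
  "bdist a b t = min (t - a) (b - t)"

definition hardy_integral :: "real \<Rightarrow> real \<Rightarrow> real \<Rightarrow> (real \<Rightarrow> real) \<Rightarrow> ennreal" where
  "hardy_integral s a b u =
     (\<integral>\<^sup>+ t\<in>{a<..<b}. ennreal (\<bar>u t\<bar>\<^sup>2 / bdist a b t powr (2 * s)) \<partial>lebesgue)"

definition hardy_const :: "real \<Rightarrow> real \<Rightarrow> real \<Rightarrow> ennreal" where
  "hardy_const s a b =
     Inf {(gagliardo s u)\<^sup>2 | u. u \<in> test_functions a b \<and> hardy_integral s a b u = 1}"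

definition Lambda :: "real \<Rightarrow> real" where
  "Lambda s =
     2 * (LINT t:{0<..<1}|lebesgue.
            \<bar>1 - t powr ((2 * s - 1) / 2)\<bar>\<^sup>2 / (1 - t) powr (1 + 2 * s)) + 1 / s"

end

theory Submission
  imports Defs
begin

text \<open>
  The inequality is a ground state representation that is exact in the Moebius geometry of the
  interval. Put \<open>rho x = (x - a) (b - x) / (b - a)\<close>, so that the weight on the left-hand side is
  \<open>rho powr (- 2 s)\<close>, and \<open>ground = rho powr (s - 1/2)\<close>, and write \<open>u = ground v\<close>. Expanding squares, the
  squared seminorm becomes a remainder, the double integral of
  \<open>ground x ground y (v x - v y)\<^sup>2 / \<bar>x - y\<bar> powr (1 + 2 s)\<close>, plus \<open>u\<^sup>2\<close> against a potential. In the
  coordinate \<open>odds x = (x - a) / (b - x)\<close> the kernel of the remainder depends only on the ratio of the two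
  coordinates, and the potential turns out to be exactly \<open>Lambda s\<close> times the weight
  (\<open>ground_state_representation\<close>). Dropping the remainder gives the inequality for test functions.

  The potential is a difference of two divergent integrals. They are compared after removing
  from the plane the pairs with \<open>rho x * rho y > M (M + 1) (x - y)\<^sup>2\<close>. For fixed \<open>x\<close> in the
  interval these \<open>y\<close> form an interval around \<open>x\<close>, so the kernel alone integrates to two explicit powers; and inside the interval
  the condition is a bound on the cross ratio, so the kernel times \<open>ground x ground y\<close> integrates to a
  constant multiple of \<open>1 / rho x\<close>. By an elementary integration (\<open>truncated_profile_identity\<close>) the difference
  of the two is the truncated version of \<open>Lambda s\<close> times the weight, up to a second
  difference of \<open>\<lambda>z. z powr (2 s)\<close>, which vanishes in the limit because \<open>2 s < 2\<close>.

  The inequality extends to the closure of the test functions because the mass over compact parts of the interval is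
  continuous in the \<open>L2\<close> norm (\<open>hardy_W_tilde\<close>). Since \<open>rho\<close> is strictly smaller than the
  distance to the boundary, the constant for the distance weight is at least \<open>Lambda s\<close> and is not attained
  (\<open>hardy_strict\<close>). It is not larger, because the ground state, cut off on a logarithmic scale by a
  bump function close to an end point, has a remainder that is negligible compared with its mass, while
  the two weights are asymptotically equal there (\<open>hardy_const_le_trial\<close>).
\<close>

section \<open>The interval in its Moebius coordinate\<close>

locale hardy_interval =
  fixes s a b :: real
  assumes s_pos: "0 < s" and s_less_1: "s < 1" and a_less_b: "a < b"
begin

text \<open>The reciprocal of \<open>1 / (x - a) + 1 / (b - x)\<close>, so the weight of the inequality is
  \<open>rho powr (- 2 s)\<close>. Up to a constant factor it is the conformal radius of the disc with diameter
  \<open>(a, b)\<close>; its covariance under Moebius maps is what makes the identities below exact. Outside the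
  interval the formula is nonpositive, a fact exploited by the relation \<open>far\<close> below.\<close>

definition rho :: "real \<Rightarrow> real" where
  "rho x = (x - a) * (b - x) / (b - a)"

text \<open>The ground state: positive in \<open>(a, b)\<close>, and once extended by zero a solution there of the
  Euler--Lagrange equation of the inequality. Up to the conformal factor it is the Moebius image of the
  power \<open>X powr (s - 1/2)\<close>, the ground state of the half-line.\<close>

definition ground :: "real \<Rightarrow> real" where
  "ground x = rho x powr (s - 1/2)"

definition ker :: "real \<Rightarrow> real \<Rightarrow> real" where
  "ker x y = 1 / \<bar>x - y\<bar> powr (1 + 2 * s)"

text \<open>The Moebius coordinate, mapping \<open>(a, b)\<close> increasingly onto the half-line.\<close>

definition odds :: "real \<Rightarrow> real" where
  "odds x = (x - a) / (b - x)"

text \<open>The cross ratio of \<open>x\<close>, \<open>y\<close> and the two end points, normalized to lie in \<open>(0, 1]\<close>.\<close>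

definition cross_ratio :: "real \<Rightarrow> real \<Rightarrow> real" where
  "cross_ratio x y = (if y \<le> x then odds y / odds x else odds x / odds y)"

text \<open>In the Moebius coordinate the measure \<open>ground x * ground y * ker x y dx dy\<close> is invariant under
  dilations, so integrating a function \<open>h\<close> of the cross ratio against it reduces to this integral over one
  ratio \<open>t\<close>.\<close>

definition mellin :: "(real \<Rightarrow> ennreal) \<Rightarrow> ennreal" where
  "mellin h = (\<integral>\<^sup>+t. h t * ennreal (t powr (s - 1/2) / (1 - t) powr (1 + 2 * s)) * indicator {0<..<1} t \<partial>lborel)"

lemma borel_measurable_rho_ground_odds [measurable]:
  "rho \<in> borel_measurable borel" "ground \<in> borel_measurable borel"
  "odds \<in> borel_measurable borel"
  unfolding rho_def[abs_def] ground_def[abs_def] odds_def[abs_def]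
  by measurable

lemma borel_measurable_ker [measurable (raw)]:
  assumes [measurable]: "f \<in> borel_measurable M" "g \<in> borel_measurable M"
  shows "(\<lambda>z. ker (f z) (g z)) \<in> borel_measurable M"
  unfolding ker_def by measurable

lemma borel_measurable_cross_ratio [measurable (raw)]:
  assumes [measurable]: "f \<in> borel_measurable M" "g \<in> borel_measurable M"
  shows "(\<lambda>z. cross_ratio (f z) (g z)) \<in> borel_measurable M"
  unfolding cross_ratio_def by measurable

lemma rho_pos: "x \<in> {a<..<b} \<Longrightarrow> 0 < rho x"
  using a_less_b by (auto simp: rho_def)

lemma ground_pos: "x \<in> {a<..<b} \<Longrightarrow> 0 < ground x"
  using rho_pos[of x] by (simp add: ground_def)

lemma ker_nonneg [simp]: "0 \<le> ker x y"
  by (simp add: ker_def)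

lemma ker_commute: "ker x y = ker y x"
  by (simp add: ker_def abs_minus_commute)

lemma ground_sq: "x \<in> {a<..<b} \<Longrightarrow> (ground x)\<^sup>2 = rho x powr (2 * s - 1)"
  using rho_pos[of x] by (simp add: ground_def power2_eq_square powr_add[symmetric])

text \<open>In terms of \<open>v = u / ground\<close> the weighted mass of \<open>u\<close> is \<open>v\<^sup>2\<close> against the invariant measure
  \<open>dx / rho x\<close>.\<close>

lemma mass_density_ratio:
  "x \<in> {a<..<b} \<Longrightarrow> (u x)\<^sup>2 * rho x powr (- (2 * s)) = (u x / ground x)\<^sup>2 * (1 / rho x)"
proof -
  assume x: "x \<in> {a<..<b}"
  have "rho x powr (- (2 * s)) = rho x powr (- (2 * s - 1) - 1)" by simp
  also have "\<dots> = 1 / ((ground x)\<^sup>2 * rho x)"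
    using rho_pos[OF x] unfolding ground_sq[OF x] by (simp only: powr_diff powr_minus powr_one) (simp add: field_simps)
  finally show ?thesis by (simp add: power_divide)
qed

text \<open>The substitution is \<open>odds y = t * odds x\<close>. All powers of \<open>rho x\<close> and of the Jacobian
  cancel up to a single factor \<open>1 / rho x\<close>; this is the conformal covariance of the fractional
  seminorm in one dimension.\<close>

lemma lower_half_integral:
  assumes x: "x \<in> {a<..<b}" and [measurable]: "h \<in> borel_measurable borel"
  shows "(\<integral>\<^sup>+y. h (odds y / odds x) * ennreal (ground x * ground y * ker x y) * indicator {a<..<x} y \<partial>lborel)
         = ennreal (1 / rho x) * mellin h"
proof -
  define \<alpha> \<beta> where ab_def: "\<alpha> = x - a" "\<beta> = b - x"
  have pos: "\<alpha> > 0" "\<beta> > 0" using x by (auto simp: ab_def)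
  have L: "b - a = \<alpha> + \<beta>" by (simp add: ab_def)
  define g where "g t = a + (\<alpha> + \<beta>) * \<alpha> * t / (\<beta> + \<alpha> * t)" for t
  define g' where "g' t = (\<alpha> + \<beta>) * \<alpha> * \<beta> / (\<beta> + \<alpha> * t)\<^sup>2" for t
  define f where "f y = h (odds y / odds x) * ennreal (ground x * ground y * ker x y) * indicator {a<..<x} y" for y
  have den: "\<beta> + \<alpha> * t > 0" if "t \<in> {0..1}" for t
    using that pos by (simp add: add_pos_nonneg)
  have der: "(g has_real_derivative g' t) (at t)" if "t \<in> {0..1}" for t
    unfolding g_def g'_def using den[OF that]
    by (auto intro!: derivative_eq_intros simp: field_simps power2_eq_square)
  have cont: "continuous_on {0..1} g'"
    unfolding g'_def using den by (intro continuous_intros) (force)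
  have ends: "g 0 = a" "g 1 = x" using pos by (auto simp: g_def ab_def field_simps)
  have pt: "f (g t) * ennreal (g' t) * indicator {0..1} t =
     ennreal (1 / rho x) * (h t * ennreal (t powr (s - 1/2) / (1 - t) powr (1 + 2 * s)) * indicator {0<..<1} t)"
    if t: "t \<notin> {0, 1}" for t
  proof (cases "t \<in> {0<..<1}")
    case True
    then have t01: "0 < t" "t < 1" by auto
    define e where "e = \<beta> + \<alpha> * t"
    have e: "e > 0" using den[of t] t01 by (auto simp: e_def)
    have ya: "g t - a = (\<alpha> + \<beta>) * \<alpha> * t / e" by (simp add: g_def e_def)
    have bmy: "b - g t = (\<alpha> + \<beta>) * \<beta> / e"
    proof -
      have "b - g t = (\<alpha> + \<beta>) - (\<alpha> + \<beta>) * \<alpha> * t / e" using L by (simp add: g_def e_def)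
      also have "\<dots> = (\<alpha> + \<beta>) * \<beta> / e" using e by (simp add: field_simps e_def)
      finally show ?thesis .
    qed
    have xy: "x - g t = \<alpha> * \<beta> * (1 - t) / e"
    proof -
      have "x - g t = \<alpha> - (\<alpha> + \<beta>) * \<alpha> * t / e" by (simp add: g_def e_def ab_def)
      also have "\<dots> = \<alpha> * \<beta> * (1 - t) / e" using e by (simp add: field_simps e_def)
      finally show ?thesis .
    qed
    have gin: "g t \<in> {a<..<x}"
    proof -
      have "g t - a > 0" unfolding ya using pos e t01 by simp
      moreover have "x - g t > 0" unfolding xy using pos e t01 by simp
      ultimately show ?thesis by simp
    qed
    have od: "odds (g t) / odds x = t"
      unfolding odds_def ya bmy using pos e by (simp add: ab_def[symmetric])
    have rx: "rho x = \<alpha> * \<beta> / (\<alpha> + \<beta>)" by (simp add: rho_def ab_def)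
    have ry: "rho (g t) = rho x * (((\<alpha> + \<beta>) / e)\<^sup>2 * t)"
      unfolding rx unfolding rho_def ya bmy L using pos e by (simp add: power2_eq_square)
    have rxp: "rho x > 0" using rho_pos[OF x] .
    have le: "(\<alpha> + \<beta>) / e > 0" using pos e by simp
    have wy: "ground (g t) = ground x * ((\<alpha> + \<beta>) / e) powr (2 * s - 1) * t powr (s - 1/2)"
    proof -
      have "(((\<alpha> + \<beta>) / e)\<^sup>2) powr (s - 1/2) = ((\<alpha> + \<beta>) / e) powr (2 * s - 1)"
      proof -
        have "(((\<alpha> + \<beta>) / e)\<^sup>2) = ((\<alpha> + \<beta>) / e) powr 2" using le by simp
        then show ?thesis by (simp only: powr_powr) (simp add: algebra_simps)
      qed
      then show ?thesis unfolding ground_def ry using rxp le t01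
        by (simp only: powr_mult mult.assoc)
    qed
    have xy2: "x - g t = rho x * ((\<alpha> + \<beta>) / e) * (1 - t)"
      unfolding xy rx using pos e by simp
    have gp: "g' t = rho x * ((\<alpha> + \<beta>) / e) powr 2"
      unfolding g'_def rx e_def[symmetric] using pos e le by (simp add: power2_eq_square)
    have kk: "ker x (g t) = 1 / (rho x powr (1 + 2 * s) * ((\<alpha> + \<beta>) / e) powr (1 + 2 * s) * (1 - t) powr (1 + 2 * s))"
      unfolding ker_def xy2 using rxp le t01 by (simp only: abs_mult abs_of_pos diff_gt_0_iff_gt powr_mult)
    \<comment> \<open>The remaining powers of \<open>rho x\<close> and of \<open>(\<alpha> + \<beta>) / e\<close> are collected separately: the first
      group leaves \<open>1 / rho x\<close>, the second cancels completely.\<close>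
    have W: "(ground x)\<^sup>2 * rho x / rho x powr (1 + 2 * s) = 1 / rho x"
    proof -
      have "(ground x)\<^sup>2 * rho x / rho x powr (1 + 2 * s) = rho x powr ((2 * s - 1) + 1 - (1 + 2 * s))"
        using rxp by (simp only: ground_sq[OF x] powr_diff powr_add powr_one)
      also have "\<dots> = 1 / rho x" using rxp by (simp add: powr_minus divide_inverse)
      finally show ?thesis .
    qed
    have E: "((\<alpha> + \<beta>) / e) powr (2 * s - 1) * ((\<alpha> + \<beta>) / e) powr 2 / ((\<alpha> + \<beta>) / e) powr (1 + 2 * s) = 1"
    proof -
      have "((\<alpha> + \<beta>) / e) powr (2 * s - 1) * ((\<alpha> + \<beta>) / e) powr 2 / ((\<alpha> + \<beta>) / e) powr (1 + 2 * s)
         = ((\<alpha> + \<beta>) / e) powr ((2 * s - 1) + 2 - (1 + 2 * s))"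
        by (simp only: powr_diff powr_add)
      also have "\<dots> = ((\<alpha> + \<beta>) / e) powr 0" by simp
      also have "\<dots> = 1" using pos e by simp
      finally show ?thesis .
    qed
    have "ground x * ground (g t) * ker x (g t) * g' t =
       ((ground x)\<^sup>2 * rho x / rho x powr (1 + 2 * s)) *
       (((\<alpha> + \<beta>) / e) powr (2 * s - 1) * ((\<alpha> + \<beta>) / e) powr 2 / ((\<alpha> + \<beta>) / e) powr (1 + 2 * s)) *
       (t powr (s - 1/2) / (1 - t) powr (1 + 2 * s))"
      unfolding wy kk gp by (simp add: power2_eq_square)
    then have main: "ground x * ground (g t) * ker x (g t) * g' t =
        1 / rho x * (t powr (s - 1/2) / (1 - t) powr (1 + 2 * s))"
      unfolding W E by simp
    have g'0: "g' t \<ge> 0" unfolding g'_def using pos by simp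
    have w0: "ground x * ground (g t) * ker x (g t) \<ge> 0"
      using ground_pos[OF x] by (simp add: ground_def)
    have "ennreal (ground x * ground (g t) * ker x (g t)) * ennreal (g' t) =
        ennreal (1 / rho x) * ennreal (t powr (s - 1/2) / (1 - t) powr (1 + 2 * s))"
      using main w0 g'0 rxp t01 by (simp only: ennreal_mult[symmetric]) (simp add: ennreal_mult[symmetric])
    then have "h t * (ennreal (ground x * ground (g t) * ker x (g t)) * ennreal (g' t)) =
        h t * (ennreal (1 / rho x) * ennreal (t powr (s - 1/2) / (1 - t) powr (1 + 2 * s)))" by simp
    then show ?thesis
      unfolding f_def od using gin True t01 by (simp add: mult_ac)
  next
    case False
    then show ?thesis using t by (auto simp: indicator_def)
  qed
  have "(\<integral>\<^sup>+y. f y \<partial>lborel) = (\<integral>\<^sup>+y. f y * indicator {g 0..g 1} y \<partial>lborel)"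
    by (intro nn_integral_cong) (auto simp: f_def ends indicator_def)
  also have "\<dots> = (\<integral>\<^sup>+t. f (g t) * g' t * indicator {0..1} t \<partial>lborel)"
  proof (rule nn_integral_substitution_aux)
    show "f \<in> borel_measurable borel" unfolding f_def[abs_def] by measurable
    show "g' t \<ge> 0" for t unfolding g'_def using pos by simp
  qed (use der cont in auto)
  also have "\<dots> = (\<integral>\<^sup>+t. ennreal (1 / rho x) * (h t * ennreal (t powr (s - 1/2) / (1 - t) powr (1 + 2 * s)) * indicator {0<..<1} t) \<partial>lborel)"
  proof (rule nn_integral_cong_AE)
    show "AE t in lborel. f (g t) * ennreal (g' t) * indicator {0..1} t =
     ennreal (1 / rho x) * (h t * ennreal (t powr (s - 1/2) / (1 - t) powr (1 + 2 * s)) * indicator {0<..<1} t)"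
      using AE_lborel_singleton[of 0] AE_lborel_singleton[of 1]
      by eventually_elim (rule pt, simp)
  qed
  also have "\<dots> = ennreal (1 / rho x) * mellin h"
    unfolding mellin_def by (rule nn_integral_cmult) measurable
  finally show ?thesis unfolding f_def .
qed

text \<open>The reflection \<open>y \<mapsto> a + b - y\<close> exchanges the two halves of the interval.\<close>

lemma upper_half_integral:
  assumes x: "x \<in> {a<..<b}" and [measurable]: "h \<in> borel_measurable borel"
  shows "(\<integral>\<^sup>+y. h (odds x / odds y) * ennreal (ground x * ground y * ker x y) * indicator {x<..<b} y \<partial>lborel)
         = ennreal (1 / rho x) * mellin h"
proof -
  define r where "r y = a + b - y" for y
  have rho_r: "rho (r y) = rho y" for y by (simp add: rho_def r_def mult.commute)
  have ground_r: "ground (r y) = ground y" for y by (simp add: ground_def rho_r)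
  have ker_r: "ker x y = ker (r x) (r y)" for y by (simp add: ker_def r_def abs_minus_commute)
  have odds_r: "odds x / odds y = odds (r y) / odds (r x)" for y by (simp add: odds_def r_def mult.commute)
  have rr: "r (r y) = y" for y by (simp add: r_def)
  have rx: "r x \<in> {a<..<b}" using x by (auto simp: r_def)
  have "(\<integral>\<^sup>+y. h (odds x / odds y) * ennreal (ground x * ground y * ker x y) * indicator {x<..<b} y \<partial>lborel) =
    ennreal \<bar>-1\<bar> * (\<integral>\<^sup>+y. h (odds x / odds (a + b + (-1) * y)) * ennreal (ground x * ground (a + b + (-1) * y) * ker x (a + b + (-1) * y)) *
      indicator {x<..<b} (a + b + (-1) * y) \<partial>lborel)"
    by (rule nn_integral_real_affine) simp_all
  also have "\<dots> = (\<integral>\<^sup>+y. h (odds y / odds (r x)) * ennreal (ground (r x) * ground y * ker (r x) y) * indicator {a<..<r x} y \<partial>lborel)"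
  proof -
    have "h (odds x / odds (a + b + (-1) * y)) * ennreal (ground x * ground (a + b + (-1) * y) * ker x (a + b + (-1) * y)) *
      indicator {x<..<b} (a + b + (-1) * y) = h (odds y / odds (r x)) * ennreal (ground (r x) * ground y * ker (r x) y) * indicator {a<..<r x} y" for y
    proof -
      have reflect: "a + b + (-1) * y = r y" by (simp add: r_def)
      have "indicator {x<..<b} (r y) = (indicator {a<..<r x} y :: ennreal)"
        by (auto simp: indicator_def r_def)
      then show ?thesis unfolding reflect by (simp only: ground_r odds_r rr ker_r)
    qed
    then show ?thesis by simp
  qed
  also have "\<dots> = ennreal (1 / rho x) * mellin h"
    using lower_half_integral[OF rx] by (simp add: rho_r)
  finally show ?thesis .
qed

lemma conformal_kernel_integral:
  assumes x: "x \<in> {a<..<b}" and h[measurable]: "h \<in> borel_measurable borel"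
  shows "(\<integral>\<^sup>+y. h (cross_ratio x y) * ennreal (ground x * ground y * ker x y) * indicator {a<..<b} y \<partial>lborel)
         = 2 * (ennreal (1 / rho x) * mellin h)"
proof -
  have "(\<integral>\<^sup>+y. h (cross_ratio x y) * ennreal (ground x * ground y * ker x y) * indicator {a<..<b} y \<partial>lborel) =
    (\<integral>\<^sup>+y. h (odds y / odds x) * ennreal (ground x * ground y * ker x y) * indicator {a<..<x} y +
           h (odds x / odds y) * ennreal (ground x * ground y * ker x y) * indicator {x<..<b} y \<partial>lborel)"
  proof (rule nn_integral_cong)
    fix y
    show "h (cross_ratio x y) * ennreal (ground x * ground y * ker x y) * indicator {a<..<b} y =
      h (odds y / odds x) * ennreal (ground x * ground y * ker x y) * indicator {a<..<x} y +
           h (odds x / odds y) * ennreal (ground x * ground y * ker x y) * indicator {x<..<b} y"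
      using x by (cases y x rule: linorder_cases) (auto simp: cross_ratio_def indicator_def ker_def)
  qed
  also have "\<dots> = 2 * (ennreal (1 / rho x) * mellin h)"
    by (subst nn_integral_add) (simp_all add: lower_half_integral[OF x h] upper_half_integral[OF x h] mult_2)
  finally show ?thesis .
qed

end

section \<open>Separated pairs and the sharp constant\<close>

text \<open>The left-hand side is the mixed second difference of \<open>\<lambda>z. z powr (2 s)\<close> with steps \<open>p\<close> and \<open>q\<close>, so it is at
  most a value of the second derivative. Since \<open>s < 1\<close>, the bound tends to 0 as \<open>M\<close> grows: so the potential
  of the truncated problem, divided by the weight, no longer depends on the point in the limit.\<close>

lemma mixed_difference_powr_bound:
  fixes M p q s :: real
  assumes s: "0 < s" "s < 1" and M: "0 < M" and pq: "0 \<le> p" "0 \<le> q" "p + q = 1"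
  shows "\<bar>(M + p) powr (2 * s) + (M + q) powr (2 * s) - (M powr (2 * s) + (M + 1) powr (2 * s))\<bar>
         \<le> 2 * M powr (2 * s - 2)"
proof -
  define k where "k u = (u + p) powr (2 * s) - u powr (2 * s)" for u
  define k' where "k' u = 2 * s * (u + p) powr (2 * s - 1) - 2 * s * u powr (2 * s - 1)" for u
  have k: "(k has_real_derivative k' u) (at u)" if "u \<ge> M" for u
    unfolding k_def k'_def using that M pq by (auto intro!: derivative_eq_intros)
  have k'_bd: "\<bar>k' u\<bar> \<le> 2 * M powr (2 * s - 2)" if u: "u \<ge> M" for u
  proof (cases "p = 0")
    case True then show ?thesis by (simp add: k'_def)
  next
    case False
    then have p: "p > 0" using pq by simp
    have "\<exists>z. u < z \<and> z < u + p \<and> 2 * s * (u + p) powr (2 * s - 1) - 2 * s * u powr (2 * s - 1) =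
        (u + p - u) * (2 * s * ((2 * s - 1) * z powr (2 * s - 2)))"
      using u M p by (intro MVT2) (auto intro!: derivative_eq_intros simp: algebra_simps)
    then obtain z where z: "u < z" "k' u = p * (2 * s * ((2 * s - 1) * z powr (2 * s - 2)))"
      unfolding k'_def by auto
    have zM: "z powr (2 * s - 2) \<le> M powr (2 * s - 2)"
      using z u M s by (intro powr_mono2') auto
    have "p * (2 * s) \<le> 1 * 2" using pq s by (intro mult_mono) auto
    then have 1: "p * (2 * s) \<le> 2" by simp
    have 2: "\<bar>2 * s - 1\<bar> * z powr (2 * s - 2) \<le> 1 * M powr (2 * s - 2)"
      using zM s by (intro mult_mono) auto
    have "\<bar>k' u\<bar> = p * (2 * s) * (\<bar>2 * s - 1\<bar> * z powr (2 * s - 2))"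
      unfolding z(2) using pq s by (simp add: abs_mult)
    also have "\<dots> \<le> 2 * (1 * M powr (2 * s - 2))"
      using pq s by (intro mult_mono[OF 1 2]) auto
    finally show ?thesis by simp
  qed
  have "\<bar>k (M + q) - k M\<bar> \<le> 2 * M powr (2 * s - 2)"
  proof (cases "q = 0")
    case True then show ?thesis by simp
  next
    case False
    then have q: "q > 0" using pq by simp
    have "\<exists>z. M < z \<and> z < M + q \<and> k (M + q) - k M = (M + q - M) * k' z"
      using q k by (intro MVT2) auto
    then obtain z where z: "M < z" "k (M + q) - k M = q * k' z" by auto
    have "q * \<bar>k' z\<bar> \<le> 1 * (2 * M powr (2 * s - 2))"
      using k'_bd[of z] z pq by (intro mult_mono) auto
    then show ?thesis using z pq by (simp add: abs_mult)
  qed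
  moreover have "k M - k (M + q) = (M + p) powr (2 * s) + (M + q) powr (2 * s) - (M powr (2 * s) + (M + 1) powr (2 * s))"
    using pq by (simp add: k_def algebra_simps)
  ultimately show ?thesis by (simp add: abs_minus_commute)
qed

context hardy_interval
begin

text \<open>The truncation of the plane away from the diagonal. Three properties make this particular
  quadratic condition convenient. It is symmetric; inside the square it is a bound on the cross ratio
  (\<open>far_iff_cross_ratio\<close>), hence compatible with the Moebius substitution; and if exactly one
  point is in the interval, then \<open>rho x * rho y \<le> 0\<close> and the condition holds automatically, so
  that the contribution of the complement of the interval needs no separate treatment.\<close>

definition far :: "real \<Rightarrow> real \<Rightarrow> real \<Rightarrow> bool" where
  "far M x y \<longleftrightarrow> rho x * rho y \<le> M * (M + 1) * (x - y)\<^sup>2"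

lemma far_commute: "far M x y = far M y x"
  by (simp add: far_def mult.commute power2_commute)

lemma far_mono: "far M x y \<Longrightarrow> 0 \<le> M \<Longrightarrow> M \<le> M' \<Longrightarrow> far M' x y"
  unfolding far_def
  by (erule order_trans) (intro mult_right_mono mult_mono, auto)

lemma pred_far [measurable (raw)]:
  assumes [measurable]: "f \<in> borel_measurable M" "g \<in> borel_measurable M"
  shows "Measurable.pred M (\<lambda>z. far k (f z) (g z))"
  unfolding far_def by measurable

text \<open>The difference of both sides of the condition factors, as a polynomial in \<open>z = y - x\<close>, into
  \<open>((M + p) z - rho x) ((M + q) z + rho x)\<close> with \<open>p = (x - a) / (b - a)\<close> and \<open>q = 1 - p\<close>. So the points
  that are not far from \<open>x\<close> form one interval around \<open>x\<close>.\<close>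

lemma far_section:
  assumes x: "x \<in> {a<..<b}" and M: "0 < M"
  shows "far M x y \<longleftrightarrow> y \<le> x - rho x / (M + (b - x) / (b - a)) \<or> x + rho x / (M + (x - a) / (b - a)) \<le> y"
proof -
  define p q z where "p = (x - a) / (b - a)" "q = (b - x) / (b - a)" "z = y - x"
  note pqz = this
  have pos: "p > 0" "q > 0" using x a_less_b by (auto simp: pqz)
  have L: "b - a > 0" using a_less_b by simp
  have pq1: "p + q = 1" using a_less_b by (simp add: pqz add_divide_distrib[symmetric])
  have rx: "rho x = (b - a) * p * q" using L by (simp add: rho_def pqz)
  have ry: "rho y = rho x + (q - p) * z - z\<^sup>2 / (b - a)"
  proof -
    have "(y - a) * (b - y) = (x - a) * (b - x) + ((b - x) - (x - a)) * z - z\<^sup>2"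
      unfolding pqz by algebra
    then have "rho y = (x - a) * (b - x) / (b - a) + ((b - x) - (x - a)) * z / (b - a) - z\<^sup>2 / (b - a)"
      by (simp only: rho_def add_divide_distrib diff_divide_distrib)
    also have "((b - x) - (x - a)) * z / (b - a) = (q - p) * z"
      by (simp only: pqz diff_divide_distrib[symmetric] times_divide_eq_left)
    finally show ?thesis by (simp add: rho_def)
  qed
  have r0: "rho x > 0" using rho_pos[OF x] .
  have rz: "rho x * (z\<^sup>2 / (b - a)) = p * q * z\<^sup>2" using L by (simp add: rx)
  have "M * (M + 1) * (x - y)\<^sup>2 - rho x * rho y =
      M * (M + 1) * z\<^sup>2 - rho x * rho x - rho x * (q - p) * z + p * q * z\<^sup>2"
    unfolding ry by (simp add: algebra_simps rz[symmetric]) (simp add: pqz power2_commute rho_def mult_ac)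
  also have "\<dots> = ((M + p) * z - rho x) * ((M + q) * z + rho x)"
  proof -
    have q: "q = 1 - p" using pq1 by simp
    show ?thesis unfolding q by algebra
  qed
  finally have "far M x y \<longleftrightarrow> 0 \<le> ((M + p) * z - rho x) * ((M + q) * z + rho x)"
    unfolding far_def by linarith
  also have "\<dots> \<longleftrightarrow> z \<le> - (rho x / (M + q)) \<or> rho x / (M + p) \<le> z"
  proof -
    have e1: "rho x / (M + p) \<le> z \<longleftrightarrow> 0 \<le> (M + p) * z - rho x"
      using M pos by (simp add: pos_divide_le_eq mult.commute)
    have e2: "z \<le> - (rho x / (M + q)) \<longleftrightarrow> (M + q) * z + rho x \<le> 0"
      using M pos by (auto simp: field_simps)
    have z1: "0 < (M + q) * z + rho x" if "0 \<le> (M + p) * z - rho x"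
    proof -
      have "0 < (M + p) * z" using that r0 by linarith
      then have "0 < z" using M pos by (simp add: zero_less_mult_iff)
      then have "0 < (M + q) * z" using M pos by simp
      then show ?thesis using r0 by linarith
    qed
    show ?thesis unfolding e1 e2 zero_le_mult_iff using z1 by argo
  qed
  finally show ?thesis by (auto simp: pqz)
qed

lemma kernel_tail_integral:
  assumes c: "0 < c"
  shows "(\<integral>\<^sup>+y. ennreal (ker x y) * indicator {x + c..} y \<partial>lborel) = ennreal (c powr (- (2 * s)) / (2 * s))"
    and "(\<integral>\<^sup>+y. ennreal (ker x y) * indicator {..x - c} y \<partial>lborel) = ennreal (c powr (- (2 * s)) / (2 * s))"
proof -
  have base: "(\<integral>\<^sup>+z. ennreal (1 / \<bar>z\<bar> powr (1 + 2 * s)) * indicator {c..} z \<partial>lborel) = ennreal (c powr (- (2 * s)) / (2 * s))"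
  proof -
    define F where "F z = - (z powr (- (2 * s)) / (2 * s))" for z :: real
    have "(\<integral>\<^sup>+z. ennreal (1 / \<bar>z\<bar> powr (1 + 2 * s)) * indicator {c..} z \<partial>lborel) = ennreal (0 - F c)"
    proof (rule nn_integral_FTC_atLeast)
      show "(F has_real_derivative 1 / \<bar>z\<bar> powr (1 + 2 * s)) (at z)" if "c \<le> z" for z
      proof -
        have z: "z > 0" using that c by simp
        have "(F has_real_derivative z powr (- (2 * s) - 1)) (at z)"
          unfolding F_def using z s_pos by (auto intro!: derivative_eq_intros)
        moreover have "z powr (- (2 * s) - 1) = 1 / \<bar>z\<bar> powr (1 + 2 * s)"
          using z powr_minus_divide[of z "1 + 2 * s"] by (simp add: minus_diff_commute)
        ultimately show ?thesis by simp
      qed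
      have "((\<lambda>z. z powr (- (2 * s))) \<longlongrightarrow> 0) at_top"
        using s_pos by (intro tendsto_neg_powr filterlim_ident) auto
      from tendsto_minus[OF tendsto_divide[OF this tendsto_const]] s_pos
      show "(F \<longlongrightarrow> 0) at_top" unfolding F_def by force
    qed auto
    then show ?thesis by (simp add: F_def)
  qed
  have "(\<integral>\<^sup>+y. ennreal (ker x y) * indicator {x + c..} y \<partial>lborel) =
    ennreal \<bar>1\<bar> * (\<integral>\<^sup>+z. ennreal (ker x (x + 1 * z)) * indicator {x + c..} (x + 1 * z) \<partial>lborel)"
    by (rule nn_integral_real_affine) simp_all
  also have "\<dots> = (\<integral>\<^sup>+z. ennreal (1 / \<bar>z\<bar> powr (1 + 2 * s)) * indicator {c..} z \<partial>lborel)"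
    by (simp add: ker_def indicator_def)
  finally show "(\<integral>\<^sup>+y. ennreal (ker x y) * indicator {x + c..} y \<partial>lborel) = ennreal (c powr (- (2 * s)) / (2 * s))"
    using base by simp
  have "(\<integral>\<^sup>+y. ennreal (ker x y) * indicator {..x - c} y \<partial>lborel) =
    ennreal \<bar>-1\<bar> * (\<integral>\<^sup>+z. ennreal (ker x (x + (-1) * z)) * indicator {..x - c} (x + (-1) * z) \<partial>lborel)"
    by (rule nn_integral_real_affine) simp_all
  also have "\<dots> = (\<integral>\<^sup>+z. ennreal (1 / \<bar>z\<bar> powr (1 + 2 * s)) * indicator {c..} z \<partial>lborel)"
    by (simp add: ker_def indicator_def)
  finally show "(\<integral>\<^sup>+y. ennreal (ker x y) * indicator {..x - c} y \<partial>lborel) = ennreal (c powr (- (2 * s)) / (2 * s))"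
    using base by simp
qed

lemma far_kernel_integral:
  assumes x: "x \<in> {a<..<b}" and M: "0 < M"
  shows "(\<integral>\<^sup>+y. ennreal (ker x y) * indicator {y. far M x y} y \<partial>lborel) =
    ennreal (1 / (2 * s) * ((M + (x - a) / (b - a)) powr (2 * s) + (M + (b - x) / (b - a)) powr (2 * s))
       * rho x powr (- (2 * s)))"
proof -
  define P Q where "P = M + (x - a) / (b - a)" "Q = M + (b - x) / (b - a)"
  note PQ = this
  have pos: "P > 0" "Q > 0" using x a_less_b M by (auto simp: PQ intro!: add_pos_nonneg)
  have r0: "rho x > 0" using rho_pos[OF x] .
  have d: "rho x / P > 0" "rho x / Q > 0" using pos r0 by auto
  have "(\<integral>\<^sup>+y. ennreal (ker x y) * indicator {y. far M x y} y \<partial>lborel) =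
    (\<integral>\<^sup>+y. ennreal (ker x y) * indicator {x + rho x / P..} y + ennreal (ker x y) * indicator {..x - rho x / Q} y \<partial>lborel)"
  proof (rule nn_integral_cong)
    fix y
    have "\<not> (y \<le> x - rho x / Q \<and> x + rho x / P \<le> y)" using d by linarith
    then show "ennreal (ker x y) * indicator {y. far M x y} y =
        ennreal (ker x y) * indicator {x + rho x / P..} y + ennreal (ker x y) * indicator {..x - rho x / Q} y"
      using far_section[OF x M, of y] by (auto simp: indicator_def PQ)
  qed
  also have "\<dots> = ennreal ((rho x / P) powr (- (2 * s)) / (2 * s)) + ennreal ((rho x / Q) powr (- (2 * s)) / (2 * s))"
    by (subst nn_integral_add) (simp_all add: kernel_tail_integral d)
  also have "\<dots> = ennreal ((rho x / P) powr (- (2 * s)) / (2 * s) + (rho x / Q) powr (- (2 * s)) / (2 * s))"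
    using s_pos by (simp add: ennreal_plus)
  also have "(rho x / P) powr (- (2 * s)) / (2 * s) + (rho x / Q) powr (- (2 * s)) / (2 * s) =
     1 / (2 * s) * (P powr (2 * s) + Q powr (2 * s)) * rho x powr (- (2 * s))"
  proof -
    have "(rho x / P) powr (- (2 * s)) = P powr (2 * s) * rho x powr (- (2 * s))" if "P > 0" for P
      using r0 that by (simp add: powr_divide powr_minus field_simps)
    then show ?thesis using pos s_pos by (simp add: field_simps)
  qed
  finally show ?thesis by (simp add: PQ)
qed

text \<open>For \<open>y \<le> x\<close> with cross ratio \<open>c\<close> one has \<open>(x - y)\<^sup>2 / (rho x * rho y) = (1 - c)\<^sup>2 / c\<close>, and
  \<open>M (M + 1) (1 - c)\<^sup>2 - c = (M - (M + 1) c) ((M + 1) - M c)\<close>, whose second factor is positive.\<close>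

lemma far_iff_cross_ratio:
  assumes x: "x \<in> {a<..<b}" and y: "y \<in> {a<..<b}" and M: "0 < M"
  shows "far M x y \<longleftrightarrow> cross_ratio x y \<le> M / (M + 1)"
proof -
  have main: "far M x y \<longleftrightarrow> odds y / odds x \<le> M / (M + 1)"
    if x: "x \<in> {a<..<b}" and y: "y \<in> {a<..<b}" and yx: "y \<le> x" for x y
  proof -
    define c where "c = odds y / odds x"
    define \<alpha> \<beta> \<gamma> \<delta> where gr: "\<alpha> = x - a" "\<beta> = b - x" "\<gamma> = y - a" "\<delta> = b - y"
    have pos: "\<alpha> > 0" "\<beta> > 0" "\<gamma> > 0" "\<delta> > 0" using x y by (auto simp: gr)
    have L: "b - a > 0" using a_less_b by simp
    have c: "c = \<gamma> * \<beta> / (\<delta> * \<alpha>)" by (simp add: c_def odds_def gr)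
    have c0: "c > 0" using pos by (simp add: c)
    have c1: "c \<le> 1"
    proof -
      have "\<gamma> * \<beta> \<le> \<delta> * \<alpha>" using yx pos by (subst mult.commute, intro mult_mono) (auto simp: gr)
      then show ?thesis using pos by (simp add: c)
    qed
    have cr: "1 - c = (b - a) * (x - y) / (\<delta> * \<alpha>)"
    proof -
      have "\<delta> * \<alpha> - \<gamma> * \<beta> = (b - a) * (x - y)" unfolding gr by algebra
      then show ?thesis using pos by (simp add: c field_simps)
    qed
    have rr: "rho x * rho y = \<alpha> * \<beta> * \<gamma> * \<delta> / (b - a)\<^sup>2"
      by (simp add: rho_def gr power2_eq_square)
    have xy: "(x - y)\<^sup>2 = rho x * rho y * ((1 - c)\<^sup>2 / c)"
    proof -
      have "w\<^sup>2 = \<alpha> * \<beta> * \<gamma> * \<delta> / D\<^sup>2 * ((D * w / (\<delta> * \<alpha>))\<^sup>2 / (\<gamma> * \<beta> / (\<delta> * \<alpha>)))" if "D > 0" for D w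
        using pos that by (simp add: power2_eq_square field_simps)
      from this[OF L] show ?thesis unfolding cr rr unfolding c .
    qed
    have rp: "rho x * rho y > 0" using rho_pos[OF x] rho_pos[OF y] by simp
    have "far M x y \<longleftrightarrow> rho x * rho y * 1 \<le> rho x * rho y * (M * (M + 1) * ((1 - c)\<^sup>2 / c))"
      unfolding far_def xy by (simp add: mult_ac)
    also have "\<dots> \<longleftrightarrow> 1 \<le> M * (M + 1) * ((1 - c)\<^sup>2 / c)"
      using rp by (simp only: mult_le_cancel_left_pos)
    also have "\<dots> \<longleftrightarrow> c \<le> M * (M + 1) * (1 - c)\<^sup>2"
      using c0 by (simp add: field_simps)
    also have "\<dots> \<longleftrightarrow> 0 \<le> (M - (M + 1) * c) * ((M + 1) - M * c)"
    proof -
      have "M * (M + 1) * (1 - c)\<^sup>2 - c = (M - (M + 1) * c) * ((M + 1) - M * c)" by algebra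
      then show ?thesis by linarith
    qed
    also have "\<dots> \<longleftrightarrow> 0 \<le> M - (M + 1) * c"
    proof -
      have "M * c \<le> M * 1" using c1 M by (intro mult_left_mono) auto
      then have "(M + 1) - M * c > 0" by linarith
      then show ?thesis by (simp add: zero_le_mult_iff)
    qed
    also have "\<dots> \<longleftrightarrow> c \<le> M / (M + 1)" using M by (simp add: field_simps)
    finally show ?thesis by (simp add: c_def)
  qed
  show ?thesis
    using main[OF x y] main[OF y x] far_commute[of M x y] by (auto simp: cross_ratio_def)
qed

definition Lambda_integrand :: "real \<Rightarrow> real" where
  "Lambda_integrand t = \<bar>1 - t powr ((2 * s - 1) / 2)\<bar>\<^sup>2 / (1 - t) powr (1 + 2 * s)"

lemma Lambda_integrand_nonneg [simp]: "0 \<le> Lambda_integrand t"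
  by (simp add: Lambda_integrand_def)

lemma borel_measurable_Lambda_integrand [measurable]: "Lambda_integrand \<in> borel_measurable borel"
  unfolding Lambda_integrand_def[abs_def] by measurable

text \<open>Expanding the square in the integrand of \<open>Lambda\<close> produces \<open>1 + t powr (2 s - 1)\<close>, which over
  \<open>(1 - t) powr (1 + 2 s)\<close> has the elementary antiderivative \<open>F\<close>, and the cross term, which is the
  \<open>mellin\<close> integral. Both that term and the right-hand side diverge as \<open>M\<close> grows, while
  the first integral converges to the one in \<open>Lambda\<close>.\<close>

lemma truncated_profile_identity:
  assumes M: "0 < M"
  shows "(\<integral>\<^sup>+t. ennreal (Lambda_integrand t) * indicator {0<..M / (M + 1)} t \<partial>lborel) + 2 * mellin (indicator {..M / (M + 1)})
      + ennreal (1 / (2 * s)) = ennreal (1 / (2 * s) * (M powr (2 * s) + (M + 1) powr (2 * s)))"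
proof -
  define m where "m = M / (M + 1)"
  have m: "0 < m" "m < 1" using M by (auto simp: m_def field_simps)
  have m1: "1 - m = 1 / (M + 1)" "m / (1 - m) = M" using M by (auto simp: m_def field_simps)
  define f where "f t = (1 + t powr (2 * s - 1)) / (1 - t) powr (1 + 2 * s)" for t :: real
  define F where "F t = ((1 - t) powr (- (2 * s)) + (t / (1 - t)) powr (2 * s)) / (2 * s)" for t :: real
  \<comment> \<open>For \<open>s < 1/2\<close> the function \<open>f\<close> is unbounded at 0, so differentiability of \<open>F\<close> is available only in the
    interior.\<close>
  have "(f has_integral F m - F 0) {0..m}"
  proof (rule fundamental_theorem_of_calculus_interior)
    show "continuous_on {0..m} F" unfolding F_def using m s_pos
      by (intro continuous_intros continuous_on_powr') auto
    fix t assume t: "t \<in> {0<..<m}"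
    then have t01: "0 < t" "t < 1" using m by auto
    have e: "(2 * s) * (t / (1 - t)) powr (2 * s - 1) * (1 / (1 - t)\<^sup>2) =
       2 * s * (t powr (2 * s - 1) / (1 - t) powr (1 + 2 * s))"
    proof -
      have "(1 - t)\<^sup>2 = (1 - t) powr 2" using t01 by simp
      moreover have "(1 - t) powr (1 + 2 * s) = (1 - t) powr (2 * s - 1) * (1 - t) powr 2"
        by (simp add: powr_add[symmetric])
      ultimately show ?thesis using t01 by (simp add: powr_divide)
    qed
    have e2: "(1 - t) powr (- (2 * s) - 1) = 1 / (1 - t) powr (1 + 2 * s)"
      using t01 powr_minus_divide[of "1 - t" "1 + 2 * s"] by (simp add: minus_diff_commute)
    have d1: "((\<lambda>t. (1 - t) powr (- (2 * s))) has_real_derivative 2 * s * (1 - t) powr (- (2 * s) - 1)) (at t)"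
      using t01 by (auto intro!: derivative_eq_intros)
    have d0: "((\<lambda>t. t / (1 - t)) has_real_derivative 1 / (1 - t)\<^sup>2) (at t)"
      using t01 by (auto intro!: derivative_eq_intros simp: power2_eq_square field_simps)
    have "((\<lambda>t. t powr (2 * s)) has_real_derivative (2 * s) * (t / (1 - t)) powr (2 * s - 1)) (at (t / (1 - t)))"
      using t01 by (intro has_real_derivative_powr) auto
    from DERIV_chain2[OF this d0]
    have d2: "((\<lambda>t. (t / (1 - t)) powr (2 * s)) has_real_derivative
       2 * s * (t powr (2 * s - 1) / (1 - t) powr (1 + 2 * s))) (at t)" unfolding e .
    have "(F has_real_derivative (2 * s * (1 - t) powr (- (2 * s) - 1) +
       2 * s * (t powr (2 * s - 1) / (1 - t) powr (1 + 2 * s))) / (2 * s)) (at t)"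
      unfolding F_def by (intro DERIV_cdivide DERIV_add d1 d2)
    also have "(2 * s * (1 - t) powr (- (2 * s) - 1) +
       2 * s * (t powr (2 * s - 1) / (1 - t) powr (1 + 2 * s))) / (2 * s) = f t"
      unfolding e2 f_def using s_pos by (simp add: field_simps add_divide_distrib)
    finally show "(F has_vector_derivative f t) (at t)"
      by (simp add: has_real_derivative_iff_has_vector_derivative)
  qed (use m in auto)
  then have "(\<integral>\<^sup>+t. ennreal (f t) * indicator {0..m} t \<partial>lborel) = ennreal (F m - F 0)"
    by (rule nn_integral_has_integral_lebesgue'[rotated]) (simp add: f_def)
  moreover have "F 0 = 1 / (2 * s)" by (simp add: F_def)
  moreover have "F m = 1 / (2 * s) * (M powr (2 * s) + (M + 1) powr (2 * s))"
    unfolding F_def m1(2) unfolding m1(1) using M by (simp add: powr_divide powr_minus field_simps)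
  ultimately have I: "(\<integral>\<^sup>+t. ennreal (f t) * indicator {0..m} t \<partial>lborel) =
     ennreal (1 / (2 * s) * (M powr (2 * s) + (M + 1) powr (2 * s)) - 1 / (2 * s))" by simp
  have "(\<integral>\<^sup>+t. ennreal (f t) * indicator {0..m} t \<partial>lborel) =
    (\<integral>\<^sup>+t. ennreal (Lambda_integrand t) * indicator {0<..m} t +
       2 * (indicator {..m} t * ennreal (t powr (s - 1/2) / (1 - t) powr (1 + 2 * s)) * indicator {0<..<1} t) \<partial>lborel)"
  proof (rule nn_integral_cong_AE)
    show "AE t in lborel. ennreal (f t) * indicator {0..m} t = ennreal (Lambda_integrand t) * indicator {0<..m} t +
       2 * (indicator {..m} t * ennreal (t powr (s - 1/2) / (1 - t) powr (1 + 2 * s)) * indicator {0<..<1} t)"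
      using AE_lborel_singleton[of 0]
    proof eventually_elim
      fix t :: real assume t0: "t \<noteq> 0"
      show "ennreal (f t) * indicator {0..m} t = ennreal (Lambda_integrand t) * indicator {0<..m} t +
       2 * (indicator {..m} t * ennreal (t powr (s - 1/2) / (1 - t) powr (1 + 2 * s)) * indicator {0<..<1} t)"
      proof (cases "t \<in> {0<..m}")
        case True
        then have t: "0 < t" "t < 1" using m by auto
        have sq: "(t powr (s - 1/2))\<^sup>2 = t powr (2 * s - 1)"
          by (simp add: power2_eq_square powr_add[symmetric])
        have sum2: "ennreal (u + 2 * v) = ennreal u + 2 * ennreal v" if "0 \<le> u" "0 \<le> v" for u v
          using that by (simp add: ennreal_mult')
        have "f t = Lambda_integrand t + 2 * (t powr (s - 1/2) / (1 - t) powr (1 + 2 * s))"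
          unfolding f_def Lambda_integrand_def sq[symmetric]
          by (simp add: diff_divide_distrib power2_diff add_divide_distrib)
        then have "ennreal (f t) = ennreal (Lambda_integrand t) + 2 * ennreal (t powr (s - 1/2) / (1 - t) powr (1 + 2 * s))"
          by (simp only: sum2 Lambda_integrand_nonneg zero_le_divide_iff powr_ge_zero simp_thms)
        then show ?thesis using True t by simp
      next
        case False
        then show ?thesis using t0 m by (auto simp: indicator_def)
      qed
    qed
  qed
  also have "\<dots> = (\<integral>\<^sup>+t. ennreal (Lambda_integrand t) * indicator {0<..m} t \<partial>lborel) + 2 * mellin (indicator {..m})"
    unfolding mellin_def by (subst nn_integral_add) (simp_all add: nn_integral_cmult)
  finally have "(\<integral>\<^sup>+t. ennreal (Lambda_integrand t) * indicator {0<..m} t \<partial>lborel) + 2 * mellin (indicator {..m})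
    = ennreal (1 / (2 * s) * (M powr (2 * s) + (M + 1) powr (2 * s)) - 1 / (2 * s))" using I by simp
  moreover have "1 / (2 * s) * 1 \<le> 1 / (2 * s) * (M powr (2 * s) + (M + 1) powr (2 * s))"
  proof (rule mult_left_mono)
    have "1 powr (2 * s) \<le> (M + 1) powr (2 * s)" using M s_pos by (intro powr_mono2) auto
    then show "1 \<le> M powr (2 * s) + (M + 1) powr (2 * s)" by (intro add_increasing powr_ge_zero) simp
  qed (use s_pos in auto)
  ultimately show ?thesis unfolding m_def using s_pos by (simp add: ennreal_plus[symmetric] del: ennreal_plus)
qed

lemma Beta_nn_integral:
  assumes "0 < c" "0 < d"
  shows "(\<integral>\<^sup>+t. ennreal (t powr (c - 1) * (1 - t) powr (d - 1)) * indicator {0..1} t \<partial>lborel) = ennreal (Beta c d)"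
  using has_integral_Beta_real[OF assms] by (rule nn_integral_has_integral_lebesgue'[rotated]) auto

text \<open>Since the exponent \<open>s - 1/2\<close> lies in \<open>(- 1/2, 1/2)\<close>, the quantity \<open>\<bar>1 - t powr (s - 1/2)\<bar>\<close> is at most \<open>1 - t\<close>,
  up to a factor \<open>t powr (s - 1/2)\<close> if the exponent is negative. The result is a sum of two
  Beta integrands.\<close>

lemma Lambda_integrand_le:
  assumes t: "0 < t" "t < 1"
  shows "Lambda_integrand t \<le> (1 - t) powr (1 - 2 * s) + t powr (2 * s - 1) * (1 - t) powr (1 - 2 * s)"
proof -
  have "\<bar>1 - t powr (s - 1/2)\<bar>\<^sup>2 \<le> (1 + t powr (2 * s - 1)) * (1 - t)\<^sup>2"
  proof (cases "s \<ge> 1/2")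
    case True
    have "t powr 1 \<le> t powr (s - 1/2)" using t s_less_1 by (intro powr_mono') auto
    moreover have "t powr (s - 1/2) \<le> 1" using t True by (intro powr_le1) auto
    ultimately have "\<bar>1 - t powr (s - 1/2)\<bar> \<le> 1 - t" using t by simp
    then have "\<bar>1 - t powr (s - 1/2)\<bar>\<^sup>2 \<le> (1 - t)\<^sup>2" by (intro power_mono) auto
    also have "\<dots> \<le> (1 + t powr (2 * s - 1)) * (1 - t)\<^sup>2" by (simp add: mult_le_cancel_right1 not_less)
    finally show ?thesis .
  next
    case False
    have "t powr 1 \<le> t powr (1/2 - s)" using t s_pos by (intro powr_mono') auto
    moreover have "t powr (1/2 - s) \<le> 1" using t False by (intro powr_le1) auto
    ultimately have 1: "\<bar>t powr (1/2 - s) - 1\<bar> \<le> 1 - t" using t by simp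
    have "1 - t powr (s - 1/2) = t powr (s - 1/2) * (t powr (1/2 - s) - 1)"
      using t by (simp add: right_diff_distrib powr_add[symmetric])
    then have "\<bar>1 - t powr (s - 1/2)\<bar> = t powr (s - 1/2) * \<bar>t powr (1/2 - s) - 1\<bar>"
      by (simp add: abs_mult)
    also have "\<dots> \<le> t powr (s - 1/2) * (1 - t)" using 1 by (intro mult_left_mono) auto
    finally have "\<bar>1 - t powr (s - 1/2)\<bar>\<^sup>2 \<le> (t powr (s - 1/2) * (1 - t))\<^sup>2" by (intro power_mono) auto
    also have "\<dots> = t powr (2 * s - 1) * (1 - t)\<^sup>2"
      by (simp add: power_mult_distrib power2_eq_square powr_add[symmetric])
    also have "\<dots> \<le> (1 + t powr (2 * s - 1)) * (1 - t)\<^sup>2" by (intro mult_right_mono) auto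
    finally show ?thesis .
  qed
  then have "Lambda_integrand t \<le> (1 + t powr (2 * s - 1)) * (1 - t)\<^sup>2 / (1 - t) powr (1 + 2 * s)"
    unfolding Lambda_integrand_def by (simp add: diff_divide_distrib divide_right_mono)
  also have "(1 - t)\<^sup>2 / (1 - t) powr (1 + 2 * s) = (1 - t) powr (1 - 2 * s)"
  proof -
    have "(1 - t)\<^sup>2 = (1 - t) powr 2" using t by simp
    then show ?thesis by (simp add: powr_diff[symmetric])
  qed
  then have "(1 + t powr (2 * s - 1)) * (1 - t)\<^sup>2 / (1 - t) powr (1 + 2 * s) =
     (1 + t powr (2 * s - 1)) * (1 - t) powr (1 - 2 * s)" by (simp only: times_divide_eq_right[symmetric])
  finally show ?thesis by (simp add: algebra_simps)
qed

text \<open>Integrability is what has to be shown: the Lebesgue integral in \<open>Lambda\<close> would be 0 by convention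
  if its integrand were not integrable.\<close>

lemma Lambda_eq: "ennreal (Lambda s) = 2 * (\<integral>\<^sup>+t. ennreal (Lambda_integrand t) * indicator {0<..<1} t \<partial>lborel) + ennreal (1 / s)"
  and Lambda_pos: "Lambda s > 0"
proof -
  have "(\<integral>\<^sup>+t. ennreal (Lambda_integrand t) * indicator {0<..<1} t \<partial>lborel) \<le>
     (\<integral>\<^sup>+t. ennreal (t powr (1 - 1) * (1 - t) powr ((2 - 2 * s) - 1)) * indicator {0..1} t +
        ennreal (t powr (2 * s - 1) * (1 - t) powr ((2 - 2 * s) - 1)) * indicator {0..1} t \<partial>lborel)"
  proof (rule nn_integral_mono)
    fix t
    show "ennreal (Lambda_integrand t) * indicator {0<..<1} t \<le> ennreal (t powr (1 - 1) * (1 - t) powr ((2 - 2 * s) - 1)) * indicator {0..1} t +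
        ennreal (t powr (2 * s - 1) * (1 - t) powr ((2 - 2 * s) - 1)) * indicator {0..1} t"
      using Lambda_integrand_le[of t] by (auto simp: indicator_def ennreal_plus[symmetric] ennreal_leI simp del: ennreal_plus)
  qed
  also have "\<dots> = (\<integral>\<^sup>+t. ennreal (t powr (1 - 1) * (1 - t) powr ((2 - 2 * s) - 1)) * indicator {0..1} t \<partial>lborel) +
     (\<integral>\<^sup>+t. ennreal (t powr (2 * s - 1) * (1 - t) powr ((2 - 2 * s) - 1)) * indicator {0..1} t \<partial>lborel)"
    by (rule nn_integral_add) measurable
  also have "\<dots> = ennreal (Beta 1 (2 - 2 * s)) + ennreal (Beta (2 * s) (2 - 2 * s))"
    using s_pos s_less_1 by (intro arg_cong2[where f = "(+)"] Beta_nn_integral) auto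
  finally have fin: "(\<integral>\<^sup>+t. ennreal (Lambda_integrand t) * indicator {0<..<1} t \<partial>lborel) < \<infinity>"
    by (auto simp: top_unique less_top[symmetric])
  have eq: "(\<integral>\<^sup>+t. ennreal (Lambda_integrand t) * indicator {0<..<1} t \<partial>lborel) =
      ennreal (LINT t:{0<..<1}|lborel. Lambda_integrand t)"
  proof -
    have e: "(\<integral>\<^sup>+t. ennreal (Lambda_integrand t) * indicator {0<..<1} t \<partial>lborel) = (\<integral>\<^sup>+t. ennreal (indicator {0<..<1} t *\<^sub>R Lambda_integrand t) \<partial>lborel)"
      by (intro nn_integral_cong) (auto simp: indicator_def)
    have "integrable lborel (\<lambda>t. indicator {0<..<1} t *\<^sub>R Lambda_integrand t)"
      using fin unfolding e by (intro integrableI_nonneg) (auto simp: less_top)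
    then show ?thesis unfolding e set_lebesgue_integral_def
      by (intro nn_integral_eq_integral) auto
  qed
  have lam: "Lambda s = 2 * (LINT t:{0<..<1}|lborel. Lambda_integrand t) + 1 / s"
    unfolding Lambda_def Lambda_integrand_def[symmetric] set_lebesgue_integral_def
    by (subst integral_completion) auto
  have nn: "0 \<le> (LINT t:{0<..<1}|lborel. Lambda_integrand t)"
    unfolding set_lebesgue_integral_def by (intro integral_nonneg_AE) auto
  show "ennreal (Lambda s) = 2 * (\<integral>\<^sup>+t. ennreal (Lambda_integrand t) * indicator {0<..<1} t \<partial>lborel) + ennreal (1 / s)"
    unfolding eq lam using nn s_pos by (simp add: ennreal_mult')
  show "Lambda s > 0" unfolding lam using nn s_pos by (simp add: add_nonneg_pos)
qed

text \<open>The squared logarithm compensates the singularity at \<open>t = 1\<close>, where \<open>ln t\<close> vanishes to first order. The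
  bound \<open>- ln t \<le> (2 / s) (1 - t) t powr (- s / 2)\<close> costs so small a power of \<open>t\<close> that the integrand stays
  integrable at 0.\<close>

lemma mellin_ln_sq_finite: "mellin (\<lambda>t. ennreal ((ln t)\<^sup>2)) < \<infinity>"
proof -
  have bd: "(ln t)\<^sup>2 * (t powr (s - 1/2) / (1 - t) powr (1 + 2 * s)) \<le>
      4 / s\<^sup>2 * (t powr (1/2 - 1) * (1 - t) powr ((2 - 2 * s) - 1))" if t: "0 < t" "t < 1" for t
  proof -
    have "- ln t \<le> (t powr (- (s/2)) * (1 - t)) / (s/2)"
    proof -
      have "ln (t powr (- (s/2))) \<le> t powr (- (s/2)) - 1" using t by (intro ln_le_minus_one) auto
      also have "\<dots> = t powr (- (s/2)) * (1 - t powr (s/2))"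
        using t by (simp add: right_diff_distrib powr_add[symmetric])
      also have "\<dots> \<le> t powr (- (s/2)) * (1 - t)"
      proof -
        have "t powr 1 \<le> t powr (s/2)" using t s_less_1 by (intro powr_mono') auto
        then show ?thesis using t by (intro mult_left_mono) auto
      qed
      finally show ?thesis using t s_pos by (simp add: ln_powr field_simps)
    qed
    moreover have "0 \<le> - ln t" using t by simp
    ultimately have "(- ln t)\<^sup>2 \<le> ((t powr (- (s/2)) * (1 - t)) / (s/2))\<^sup>2" by (intro power_mono)
    also have "\<dots> = 4 / s\<^sup>2 * (t powr (- s) * (1 - t)\<^sup>2)"
    proof -
      have "(t powr (- (s/2)))\<^sup>2 = t powr (- s)" by (simp add: power2_eq_square powr_add[symmetric])
      then show ?thesis by (simp add: power_mult_distrib power_divide)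
    qed
    finally have "(ln t)\<^sup>2 * (t powr (s - 1/2) / (1 - t) powr (1 + 2 * s)) \<le>
      4 / s\<^sup>2 * (t powr (- s) * (1 - t)\<^sup>2) * (t powr (s - 1/2) / (1 - t) powr (1 + 2 * s))"
      by (intro mult_right_mono) auto
    also have "\<dots> = 4 / s\<^sup>2 * ((t powr (- s) * t powr (s - 1/2)) * ((1 - t)\<^sup>2 / (1 - t) powr (1 + 2 * s)))"
      by simp
    also have "(1 - t)\<^sup>2 / (1 - t) powr (1 + 2 * s) = (1 - t) powr ((2 - 2 * s) - 1)"
    proof -
      have "(1 - t)\<^sup>2 = (1 - t) powr 2" using t by simp
      then show ?thesis by (simp add: powr_diff[symmetric])
    qed
    also have "t powr (- s) * t powr (s - 1/2) = t powr (1/2 - 1)" by (simp add: powr_add[symmetric])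
    finally show ?thesis .
  qed
  have "mellin (\<lambda>t. ennreal ((ln t)\<^sup>2)) \<le>
     (\<integral>\<^sup>+t. ennreal (4 / s\<^sup>2) * (ennreal (t powr (1/2 - 1) * (1 - t) powr ((2 - 2 * s) - 1)) * indicator {0..1} t) \<partial>lborel)"
    unfolding mellin_def
  proof (rule nn_integral_mono)
    fix t
    show "ennreal ((ln t)\<^sup>2) * ennreal (t powr (s - 1/2) / (1 - t) powr (1 + 2 * s)) * indicator {0<..<1} t \<le>
      ennreal (4 / s\<^sup>2) * (ennreal (t powr (1/2 - 1) * (1 - t) powr ((2 - 2 * s) - 1)) * indicator {0..1} t)"
      using bd[of t] by (auto simp: indicator_def ennreal_mult[symmetric] intro!: ennreal_leI)
  qed
  also have "\<dots> = ennreal (4 / s\<^sup>2) * (\<integral>\<^sup>+t. ennreal (t powr (1/2 - 1) * (1 - t) powr ((2 - 2 * s) - 1)) * indicator {0..1} t \<partial>lborel)"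
    by (rule nn_integral_cmult) measurable
  also have "\<dots> = ennreal (4 / s\<^sup>2) * ennreal (Beta (1/2) (2 - 2 * s))"
    using s_less_1 by (intro arg_cong2[where f = "(*)"] Beta_nn_integral refl) auto
  also have "\<dots> < \<infinity>" by (simp add: ennreal_mult_less_top)
  finally show ?thesis .
qed

end

section \<open>The ground state representation\<close>

lemma ennreal_sqrt_sq: "(ennreal_sqrt x)\<^sup>2 = x"
proof (cases x)
  case (real r)
  then show ?thesis by (simp add: ennreal_sqrt_def ennreal_power)
next
  case top
  then show ?thesis by (simp add: ennreal_sqrt_def infinity_ennreal_def power2_eq_square ennreal_top_mult_left)
qed

lemma nn_integral_plane_symmetrize:
  fixes F :: "real \<times> real \<Rightarrow> ennreal"
  assumes [measurable]: "F \<in> borel_measurable (lborel \<Otimes>\<^sub>M lborel)"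
  shows "(\<integral>\<^sup>+z. F z + F (snd z, fst z) \<partial>(lborel \<Otimes>\<^sub>M lborel)) = 2 * (\<integral>\<^sup>+x. \<integral>\<^sup>+y. F (x, y) \<partial>lborel \<partial>lborel)"
proof -
  have [measurable]: "(\<lambda>z. F (snd z, fst z)) \<in> borel_measurable (lborel \<Otimes>\<^sub>M lborel)"
    by (rule measurable_compose[OF _ assms]) measurable
  have "(\<integral>\<^sup>+z. F z + F (snd z, fst z) \<partial>(lborel \<Otimes>\<^sub>M lborel)) =
     (\<integral>\<^sup>+z. F z \<partial>(lborel \<Otimes>\<^sub>M lborel)) + (\<integral>\<^sup>+z. F (snd z, fst z) \<partial>(lborel \<Otimes>\<^sub>M lborel))"
    by (rule nn_integral_add) measurable
  also have "(\<integral>\<^sup>+z. F z \<partial>(lborel \<Otimes>\<^sub>M lborel)) = (\<integral>\<^sup>+x. \<integral>\<^sup>+y. F (x, y) \<partial>lborel \<partial>lborel)"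
    by (rule lborel.nn_integral_fst[symmetric]) measurable
  also have "(\<integral>\<^sup>+z. F (snd z, fst z) \<partial>(lborel \<Otimes>\<^sub>M lborel)) = (\<integral>\<^sup>+x. \<integral>\<^sup>+y. F (x, y) \<partial>lborel \<partial>lborel)"
    by (subst lborel_pair.nn_integral_snd[symmetric]) simp_all
  finally show ?thesis by (simp add: mult_2)
qed

context hardy_interval
begin

definition gagliardo_quotient :: "(real \<Rightarrow> real) \<Rightarrow> real \<times> real \<Rightarrow> ennreal" where
  "gagliardo_quotient u z = ennreal ((u (fst z) - u (snd z))\<^sup>2 * ker (fst z) (snd z))"

lemma gagliardo_sq: "(gagliardo s u)\<^sup>2 = (\<integral>\<^sup>+z. gagliardo_quotient u z \<partial>(lborel \<Otimes>\<^sub>M lborel))"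
  unfolding gagliardo_def ennreal_sqrt_sq nn_integral_completion lborel_prod
  by (intro nn_integral_cong) (auto simp: gagliardo_quotient_def ker_def)

definition ground_quotient :: "(real \<Rightarrow> real) \<Rightarrow> real \<times> real \<Rightarrow> ennreal" where
  "ground_quotient u z = (\<lambda>(x, y). ennreal (ground x * ground y * ker x y * (u x / ground x - u y / ground y)\<^sup>2)
      * indicator ({a<..<b} \<times> {a<..<b}) (x, y)) z"

definition conformal_mass :: "(real \<Rightarrow> real) \<Rightarrow> ennreal" where
  "conformal_mass u = (\<integral>\<^sup>+x. ennreal ((u x)\<^sup>2 * rho x powr (- (2 * s))) * indicator {a<..<b} x \<partial>lborel)"

lemma borel_measurable_gagliardo_quotient [measurable]:
  assumes [measurable]: "u \<in> borel_measurable borel"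
  shows "gagliardo_quotient u \<in> borel_measurable (lborel \<Otimes>\<^sub>M lborel)"
  unfolding gagliardo_quotient_def[abs_def] by measurable

lemma borel_measurable_ground_quotient [measurable]:
  assumes [measurable]: "u \<in> borel_measurable borel"
  shows "ground_quotient u \<in> borel_measurable (lborel \<Otimes>\<^sub>M lborel)"
  unfolding ground_quotient_def[abs_def] by measurable

lemma far_integral_tendsto:
  fixes F :: "real \<times> real \<Rightarrow> ennreal"
  assumes [measurable]: "F \<in> borel_measurable (lborel \<Otimes>\<^sub>M lborel)" and diag: "\<And>x. F (x, x) = 0"
  shows "(\<lambda>n. \<integral>\<^sup>+z. F z * indicator {z. far (real (Suc n)) (fst z) (snd z)} z \<partial>(lborel \<Otimes>\<^sub>M lborel))
     \<longlonglongrightarrow> (\<integral>\<^sup>+z. F z \<partial>(lborel \<Otimes>\<^sub>M lborel))"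
proof (rule nn_integral_LIMSEQ)
  show "incseq (\<lambda>n z. F z * indicator {z. far (real (Suc n)) (fst z) (snd z)} z)"
    using far_mono
    by (auto intro!: incseq_SucI le_funI mult_left_mono simp: indicator_def)
  show "(\<lambda>z. F z * indicator {z. far (real (Suc n)) (fst z) (snd z)} z) \<in> borel_measurable (lborel \<Otimes>\<^sub>M lborel)" for n
    by measurable
  fix z :: "real \<times> real"
  obtain x y where z: "z = (x, y)" by (cases z)
  show "(\<lambda>n. F z * indicator {z. far (real (Suc n)) (fst z) (snd z)} z) \<longlonglongrightarrow> F z"
  proof (cases "x = y")
    case True
    then show ?thesis by (simp add: z diag)
  next
    case False
    then have xy: "(x - y)\<^sup>2 > 0" by simp
    obtain N where N: "rho x * rho y / (x - y)\<^sup>2 < real N" using reals_Archimedean2 by blast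
    have far: "far (real (Suc n)) x y" if "n \<ge> N" for n
    proof -
      have "rho x * rho y / (x - y)\<^sup>2 \<le> real (Suc n) * (real (Suc n) + 1)"
      proof -
        have "real N \<le> real (Suc n) * 1" using that by simp
        also have "\<dots> \<le> real (Suc n) * (real (Suc n) + 1)" by (intro mult_left_mono) auto
        finally show ?thesis using N by simp
      qed
      then show ?thesis unfolding far_def using xy by (simp add: pos_divide_le_eq)
    qed
    have "eventually (\<lambda>n. F z * indicator {z. far (real (Suc n)) (fst z) (snd z)} z = F z) sequentially"
      using eventually_ge_at_top[of N] by eventually_elim (use far in \<open>simp add: z\<close>)
    then show ?thesis by (rule tendsto_eventually)
  qed
qed

text \<open>The pointwise identity behind this, for \<open>u = ground v\<close> and both points inside, is
  \<open>(u x - u y)\<^sup>2 + ground x ground y (v x\<^sup>2 + v y\<^sup>2) = ground x ground y (v x - v y)\<^sup>2 + u x\<^sup>2 + u y\<^sup>2\<close>. It is multiplied by the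
  kernel and integrated over the far pairs, where each of the four terms is finite if \<open>u\<close> has finite
  weighted mass; nothing is subtracted, so no principal value is needed. The term with \<open>v x\<^sup>2 + v y\<^sup>2\<close> is
  computed by the Moebius substitution, the one with \<open>u x\<^sup>2 + u y\<^sup>2\<close> by the two power tails of the kernel.\<close>

lemma truncated_ground_state:
  assumes [measurable]: "u \<in> borel_measurable borel" and u0: "\<And>x. x \<notin> {a<..<b} \<Longrightarrow> u x = 0"
    and M: "0 < M"
  shows "(\<integral>\<^sup>+z. gagliardo_quotient u z * indicator {z. far M (fst z) (snd z)} z \<partial>(lborel \<Otimes>\<^sub>M lborel))
        + 4 * mellin (indicator {..M / (M + 1)}) * conformal_mass u =
    (\<integral>\<^sup>+z. ground_quotient u z * indicator {z. far M (fst z) (snd z)} z \<partial>(lborel \<Otimes>\<^sub>M lborel))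
        + 2 * (\<integral>\<^sup>+x. ennreal (1 / (2 * s) * ((M + (x - a) / (b - a)) powr (2 * s) + (M + (b - x) / (b - a)) powr (2 * s)))
           * (ennreal ((u x)\<^sup>2 * rho x powr (- (2 * s))) * indicator {a<..<b} x) \<partial>lborel)"
    (is "?G + ?C = ?R + ?P")
proof -
  define far_ind :: "real \<times> real \<Rightarrow> ennreal" where "far_ind = indicator {z. far M (fst z) (snd z)}"
  have far_ind_swap: "far_ind (y, x) = far_ind (x, y)" for x y
    by (simp add: far_ind_def indicator_def far_commute)
  have [measurable]: "far_ind \<in> borel_measurable (lborel \<Otimes>\<^sub>M lborel)"
    unfolding far_ind_def by measurable
  define box :: "real \<times> real \<Rightarrow> ennreal" where "box = indicator ({a<..<b} \<times> {a<..<b})"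
  have [measurable]: "box \<in> borel_measurable (lborel \<Otimes>\<^sub>M lborel)" unfolding box_def by measurable
  have box_swap: "box (y, x) = box (x, y)" for x y by (auto simp: box_def indicator_def)
  define C where "C z = ennreal ((u (fst z) / ground (fst z))\<^sup>2 * (ground (fst z) * ground (snd z) * ker (fst z) (snd z))) * box z * far_ind z" for z
  define P where "P z = ennreal ((u (fst z))\<^sup>2 * ker (fst z) (snd z)) * far_ind z" for z
  have [measurable]: "C \<in> borel_measurable (lborel \<Otimes>\<^sub>M lborel)" "P \<in> borel_measurable (lborel \<Otimes>\<^sub>M lborel)"
    unfolding C_def[abs_def] P_def[abs_def] by measurable
  have [measurable]: "(\<lambda>z. C (snd z, fst z)) \<in> borel_measurable (lborel \<Otimes>\<^sub>M lborel)"
    "(\<lambda>z. P (snd z, fst z)) \<in> borel_measurable (lborel \<Otimes>\<^sub>M lborel)"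
    by (rule measurable_compose[where f = "\<lambda>z. (snd z, fst z)"], measurable)+
  have pointwise: "gagliardo_quotient u z * far_ind z + (C z + C (snd z, fst z)) = ground_quotient u z * far_ind z + (P z + P (snd z, fst z))" for z
  proof -
    obtain x y where z: "z = (x, y)" by (cases z)
    show ?thesis
    proof (cases "x \<in> {a<..<b} \<and> y \<in> {a<..<b}")
      case True
      then have w: "ground x > 0" "ground y > 0" using ground_pos by auto
      define k where "k = ker x y"
      have k0: "k \<ge> 0" by (simp add: k_def)
      have id: "(u x - u y)\<^sup>2 * k + ((u x / ground x)\<^sup>2 * (ground x * ground y * k) + (u y / ground y)\<^sup>2 * (ground y * ground x * k)) =
         ground x * ground y * k * (u x / ground x - u y / ground y)\<^sup>2 + ((u x)\<^sup>2 * k + (u y)\<^sup>2 * k)"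
        using w by (simp add: power2_eq_square field_simps)
      have "ennreal ((u x - u y)\<^sup>2 * k) + (ennreal ((u x / ground x)\<^sup>2 * (ground x * ground y * k)) + ennreal ((u y / ground y)\<^sup>2 * (ground y * ground x * k))) =
         ennreal (ground x * ground y * k * (u x / ground x - u y / ground y)\<^sup>2) + (ennreal ((u x)\<^sup>2 * k) + ennreal ((u y)\<^sup>2 * k))"
        using w k0 arg_cong[OF id, of ennreal] by (simp add: ennreal_plus[symmetric] del: ennreal_plus)
      then have "ennreal ((u x - u y)\<^sup>2 * k) * far_ind (x, y) + (ennreal ((u x / ground x)\<^sup>2 * (ground x * ground y * k)) * far_ind (x, y) + ennreal ((u y / ground y)\<^sup>2 * (ground y * ground x * k)) * far_ind (x, y)) =
         ennreal (ground x * ground y * k * (u x / ground x - u y / ground y)\<^sup>2) * far_ind (x, y) + (ennreal ((u x)\<^sup>2 * k) * far_ind (x, y) + ennreal ((u y)\<^sup>2 * k) * far_ind (x, y))"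
        by (simp only: distrib_right[symmetric])
      then show ?thesis using True
        by (simp add: z gagliardo_quotient_def ground_quotient_def C_def P_def box_def far_ind_swap ker_commute[of y x] k_def[symmetric])
    next
      case False
      \<comment> \<open>At least one of the two values vanishes, so there is no cross term.\<close>
      then have "u x = 0 \<or> u y = 0" using u0 by auto
      then have "(u x - u y)\<^sup>2 = (u x)\<^sup>2 + (u y)\<^sup>2" by auto
      moreover have "box (x, y) = 0" using False by (auto simp: box_def)
      ultimately show ?thesis using False
        by (auto simp: z gagliardo_quotient_def ground_quotient_def C_def P_def box_swap[of y x] far_ind_swap[of x y] ker_commute[of y x]
            distrib_right ennreal_plus)
    qed
  qed
  have C_int: "(\<integral>\<^sup>+x. \<integral>\<^sup>+y. C (x, y) \<partial>lborel \<partial>lborel) = 2 * mellin (indicator {..M / (M + 1)}) * conformal_mass u"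
  proof -
    have "(\<integral>\<^sup>+y. C (x, y) \<partial>lborel) = 2 * mellin (indicator {..M / (M + 1)}) * (ennreal ((u x)\<^sup>2 * rho x powr (- (2 * s))) * indicator {a<..<b} x)" for x
    proof (cases "x \<in> {a<..<b}")
      case True
      have "(\<integral>\<^sup>+y. C (x, y) \<partial>lborel) = (\<integral>\<^sup>+y. ennreal ((u x / ground x)\<^sup>2) *
          (indicator {..M / (M + 1)} (cross_ratio x y) * ennreal (ground x * ground y * ker x y) * indicator {a<..<b} y) \<partial>lborel)"
      proof (rule nn_integral_cong)
        fix y
        show "C (x, y) = ennreal ((u x / ground x)\<^sup>2) *
          (indicator {..M / (M + 1)} (cross_ratio x y) * ennreal (ground x * ground y * ker x y) * indicator {a<..<b} y)"
        proof (cases "y \<in> {a<..<b}")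
          case y: True
          have "0 \<le> ground x * ground y * ker x y" using ground_pos[OF True] ground_pos[OF y] by simp
          then show ?thesis using True y far_iff_cross_ratio[OF True y M]
            by (simp add: C_def box_def far_ind_def indicator_def ennreal_mult)
        next
          case False
          then show ?thesis by (simp add: C_def box_def)
        qed
      qed
      also have "\<dots> = ennreal ((u x / ground x)\<^sup>2) * (2 * (ennreal (1 / rho x) * mellin (indicator {..M / (M + 1)})))"
        by (subst nn_integral_cmult) (simp_all add: conformal_kernel_integral[OF True])
      also have "\<dots> = 2 * mellin (indicator {..M / (M + 1)}) * (ennreal ((u x / ground x)\<^sup>2) * ennreal (1 / rho x))"
        by (simp add: mult_ac)
      also have "ennreal ((u x / ground x)\<^sup>2) * ennreal (1 / rho x) = ennreal ((u x / ground x)\<^sup>2 * (1 / rho x))"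
        using rho_pos[OF True] by (intro ennreal_mult[symmetric]) auto
      also have "(u x / ground x)\<^sup>2 * (1 / rho x) = (u x)\<^sup>2 * rho x powr (- (2 * s))"
        by (rule mass_density_ratio[OF True, symmetric])
      finally show ?thesis using True by simp
    next
      case False
      then show ?thesis by (simp add: C_def box_def indicator_times)
    qed
    then have "(\<integral>\<^sup>+x. \<integral>\<^sup>+y. C (x, y) \<partial>lborel \<partial>lborel) =
      (\<integral>\<^sup>+x. 2 * mellin (indicator {..M / (M + 1)}) * (ennreal ((u x)\<^sup>2 * rho x powr (- (2 * s))) * indicator {a<..<b} x) \<partial>lborel)"
      by simp
    also have "\<dots> = 2 * mellin (indicator {..M / (M + 1)}) * conformal_mass u"
      unfolding conformal_mass_def by (rule nn_integral_cmult) measurable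
    finally show ?thesis .
  qed
  have P_int: "(\<integral>\<^sup>+x. \<integral>\<^sup>+y. P (x, y) \<partial>lborel \<partial>lborel) =
     (\<integral>\<^sup>+x. ennreal (1 / (2 * s) * ((M + (x - a) / (b - a)) powr (2 * s) + (M + (b - x) / (b - a)) powr (2 * s)))
           * (ennreal ((u x)\<^sup>2 * rho x powr (- (2 * s))) * indicator {a<..<b} x) \<partial>lborel)"
  proof (rule nn_integral_cong)
    fix x
    show "(\<integral>\<^sup>+y. P (x, y) \<partial>lborel) = ennreal (1 / (2 * s) * ((M + (x - a) / (b - a)) powr (2 * s) + (M + (b - x) / (b - a)) powr (2 * s)))
           * (ennreal ((u x)\<^sup>2 * rho x powr (- (2 * s))) * indicator {a<..<b} x)"
    proof (cases "x \<in> {a<..<b}")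
      case True
      have "(\<integral>\<^sup>+y. P (x, y) \<partial>lborel) = (\<integral>\<^sup>+y. ennreal ((u x)\<^sup>2) * (ennreal (ker x y) * indicator {y. far M x y} y) \<partial>lborel)"
        by (intro nn_integral_cong) (simp add: P_def far_ind_def indicator_def ennreal_mult)
      also have "\<dots> = ennreal ((u x)\<^sup>2) * ennreal (1 / (2 * s) * ((M + (x - a) / (b - a)) powr (2 * s) + (M + (b - x) / (b - a)) powr (2 * s))
          * rho x powr (- (2 * s)))"
        by (subst nn_integral_cmult) (simp_all add: far_kernel_integral[OF True M])
      finally show ?thesis using True s_pos
        by (simp add: ennreal_mult[symmetric] mult_ac)
    next
      case False
      then show ?thesis using u0 by (simp add: P_def)
    qed
  qed
  have "(\<integral>\<^sup>+z. gagliardo_quotient u z * far_ind z + (C z + C (snd z, fst z)) \<partial>(lborel \<Otimes>\<^sub>M lborel)) =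
     (\<integral>\<^sup>+z. gagliardo_quotient u z * far_ind z \<partial>(lborel \<Otimes>\<^sub>M lborel)) + (\<integral>\<^sup>+z. C z + C (snd z, fst z) \<partial>(lborel \<Otimes>\<^sub>M lborel))"
    by (rule nn_integral_add) measurable
  moreover have "(\<integral>\<^sup>+z. ground_quotient u z * far_ind z + (P z + P (snd z, fst z)) \<partial>(lborel \<Otimes>\<^sub>M lborel)) =
     (\<integral>\<^sup>+z. ground_quotient u z * far_ind z \<partial>(lborel \<Otimes>\<^sub>M lborel)) + (\<integral>\<^sup>+z. P z + P (snd z, fst z) \<partial>(lborel \<Otimes>\<^sub>M lborel))"
    by (rule nn_integral_add) measurable
  moreover have "(\<integral>\<^sup>+z. C z + C (snd z, fst z) \<partial>(lborel \<Otimes>\<^sub>M lborel)) = 2 * (2 * mellin (indicator {..M / (M + 1)}) * conformal_mass u)"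
    unfolding C_int[symmetric] by (rule nn_integral_plane_symmetrize) measurable
  moreover have "(\<integral>\<^sup>+z. P z + P (snd z, fst z) \<partial>(lborel \<Otimes>\<^sub>M lborel)) = 2 * (\<integral>\<^sup>+x. \<integral>\<^sup>+y. P (x, y) \<partial>lborel \<partial>lborel)"
    by (rule nn_integral_plane_symmetrize) measurable
  moreover have "(\<integral>\<^sup>+z. gagliardo_quotient u z * far_ind z + (C z + C (snd z, fst z)) \<partial>(lborel \<Otimes>\<^sub>M lborel)) =
     (\<integral>\<^sup>+z. ground_quotient u z * far_ind z + (P z + P (snd z, fst z)) \<partial>(lborel \<Otimes>\<^sub>M lborel))"
    by (simp only: pointwise)
  moreover have "2 * (2 * mellin (indicator {..M / (M + 1)}) * conformal_mass u) = ?C"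
    by (simp add: mult.assoc[symmetric])
  ultimately show ?thesis
    unfolding P_int far_ind_def by (simp only:)
qed

text \<open>The sharp inequality with its exact remainder. In the truncated identity the common divergent
  part \<open>4 J n * H\<close> is cancelled, which is legitimate because it is finite for each \<open>n\<close>; by
  \<open>truncated_profile_identity\<close> what is left of the potential is \<open>lam n\<close>, which increases to
  \<open>Lambda s\<close>, up to the second difference \<open>err n\<close>, which tends to 0.\<close>

theorem ground_state_representation:
  assumes u[measurable]: "u \<in> borel_measurable borel" and u0: "\<And>x. x \<notin> {a<..<b} \<Longrightarrow> u x = 0"
    and fin: "conformal_mass u < \<infinity>"
  shows "(gagliardo s u)\<^sup>2 = (\<integral>\<^sup>+z. ground_quotient u z \<partial>(lborel \<Otimes>\<^sub>M lborel)) + ennreal (Lambda s) * conformal_mass u"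
proof -
  define H where "H = conformal_mass u"
  define M where "M n = real (Suc n)" for n
  have M0: "M n > 0" for n by (simp add: M_def)
  define G where "G n = (\<integral>\<^sup>+z. gagliardo_quotient u z * indicator {z. far (M n) (fst z) (snd z)} z \<partial>(lborel \<Otimes>\<^sub>M lborel))" for n
  define R where "R n = (\<integral>\<^sup>+z. ground_quotient u z * indicator {z. far (M n) (fst z) (snd z)} z \<partial>(lborel \<Otimes>\<^sub>M lborel))" for n
  define J where "J n = mellin (indicator {..M n / (M n + 1)})" for n
  define lam where "lam n = 2 * (\<integral>\<^sup>+t. ennreal (Lambda_integrand t) * indicator {0<..M n / (M n + 1)} t \<partial>lborel) + ennreal (1 / s)" for n
  define err where "err n = 1 / s * (2 * M n powr (2 * s - 2))" for n
  define pm where "pm n = M n powr (2 * s) + (M n + 1) powr (2 * s)" for n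
  define pp where "pp n x = (M n + (x - a) / (b - a)) powr (2 * s) + (M n + (b - x) / (b - a)) powr (2 * s)" for n x
  define mass where "mass x = ennreal ((u x)\<^sup>2 * rho x powr (- (2 * s))) * indicator {a<..<b} x" for x
  have [measurable]: "mass \<in> borel_measurable lborel" unfolding mass_def[abs_def] by measurable
  have H: "H = (\<integral>\<^sup>+x. mass x \<partial>lborel)" by (simp add: H_def conformal_mass_def mass_def)
  define P where "P n = 2 * (\<integral>\<^sup>+x. ennreal (1 / (2 * s) * pp n x) * mass x \<partial>lborel)" for n
  have err0: "err n \<ge> 0" for n using s_pos by (simp add: err_def)
  have bal: "G n + 4 * J n * H = R n + P n" for n
    using truncated_ground_state[OF u u0 M0[of n]] by (simp add: G_def J_def H_def R_def P_def pp_def mass_def)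
  have Jlam: "4 * J n + lam n = ennreal (1 / s * pm n)" for n
  proof -
    have "2 * ((\<integral>\<^sup>+t. ennreal (Lambda_integrand t) * indicator {0<..M n / (M n + 1)} t \<partial>lborel) + 2 * J n + ennreal (1 / (2 * s)))
      = 2 * ennreal (1 / (2 * s) * pm n)"
      unfolding J_def pm_def truncated_profile_identity[OF M0] ..
    also have "\<dots> = ennreal (1 / s * pm n)"
      using s_pos by (subst ennreal_numeral[symmetric], subst ennreal_mult[symmetric]) (auto simp: pm_def field_simps)
    finally have "2 * (\<integral>\<^sup>+t. ennreal (Lambda_integrand t) * indicator {0<..M n / (M n + 1)} t \<partial>lborel) + 2 * (2 * J n) + 2 * ennreal (1 / (2 * s))
       = ennreal (1 / s * pm n)" by (simp only: distrib_left)
    moreover have "2 * ennreal (1 / (2 * s)) = ennreal (1 / s)"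
      using s_pos by (subst ennreal_numeral[symmetric], subst ennreal_mult[symmetric]) auto
    ultimately show ?thesis unfolding lam_def by (simp add: ac_simps mult.assoc[symmetric])
  qed
  have Jfin: "J n < \<infinity>" for n
  proof -
    have "4 * J n \<le> ennreal (1 / s * pm n)" unfolding Jlam[symmetric] by simp
    then have "4 * J n < \<infinity>" by (auto simp: top_unique less_top[symmetric])
    then show ?thesis by (auto simp: ennreal_mult_less_top)
  qed
  have JHfin: "4 * J n * H \<noteq> \<infinity>" for n
    using Jfin[of n] fin by (auto simp: H_def ennreal_mult_eq_top_iff)
  have pp_bd: "\<bar>pp n x - pm n\<bar> \<le> 2 * M n powr (2 * s - 2)" if "x \<in> {a<..<b}" for n x
    unfolding pp_def pm_def using that s_pos s_less_1 a_less_b M0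
    by (intro mixed_difference_powr_bound) (auto simp: add_divide_distrib[symmetric])
  have pp0: "pp n x \<ge> 0" for n x by (simp add: pp_def)
  have pm0: "pm n \<ge> 0" for n by (simp add: pm_def)
  have P_eq: "P n = (\<integral>\<^sup>+x. ennreal (1 / s * pp n x) * mass x \<partial>lborel)" for n
  proof -
    have [measurable]: "pp n \<in> borel_measurable borel" unfolding pp_def[abs_def] by measurable
    have double: "2 * (ennreal (1 / (2 * s) * pp n x) * mass x) = ennreal (1 / s * pp n x) * mass x" for x
    proof -
      have "2 * ennreal (1 / (2 * s) * pp n x) = ennreal (1 / s * pp n x)"
        using s_pos pp0 by (subst ennreal_numeral[symmetric], subst ennreal_mult[symmetric]) auto
      then show ?thesis by (simp only: mult.assoc[symmetric])
    qed
    show ?thesis unfolding P_def double[symmetric] by (rule nn_integral_cmult[symmetric]) measurable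
  qed
  have P_le: "P n \<le> (4 * J n + lam n + ennreal (err n)) * H" for n
  proof -
    have "P n \<le> (\<integral>\<^sup>+x. ennreal (1 / s * pm n + err n) * mass x \<partial>lborel)"
      unfolding P_eq
    proof (rule nn_integral_mono)
      fix x
      show "ennreal (1 / s * pp n x) * mass x \<le> ennreal (1 / s * pm n + err n) * mass x"
      proof (cases "x \<in> {a<..<b}")
        case True
        have "pp n x \<le> pm n + 2 * M n powr (2 * s - 2)" using pp_bd[OF True, of n] by simp
        then have "1 / s * pp n x \<le> 1 / s * (pm n + 2 * M n powr (2 * s - 2))"
          using s_pos by (intro mult_left_mono) auto
        then show ?thesis by (intro mult_right_mono ennreal_leI) (auto simp: err_def distrib_left)
      qed (simp add: mass_def)
    qed
    also have "\<dots> = ennreal (1 / s * pm n + err n) * H"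
      unfolding H by (rule nn_integral_cmult) measurable
    also have "ennreal (1 / s * pm n + err n) = 4 * J n + lam n + ennreal (err n)"
      unfolding Jlam using err0 pm0 s_pos by (intro ennreal_plus) auto
    finally show ?thesis .
  qed
  have P_ge: "(4 * J n + lam n) * H \<le> P n + ennreal (err n) * H" for n
  proof -
    have [measurable]: "pp n \<in> borel_measurable borel" unfolding pp_def[abs_def] by measurable
    have "(4 * J n + lam n) * H = (\<integral>\<^sup>+x. ennreal (1 / s * pm n) * mass x \<partial>lborel)"
      unfolding H Jlam by (rule nn_integral_cmult[symmetric]) measurable
    also have "\<dots> \<le> (\<integral>\<^sup>+x. ennreal (1 / s * pp n x) * mass x + ennreal (err n) * mass x \<partial>lborel)"
    proof (rule nn_integral_mono)
      fix x
      show "ennreal (1 / s * pm n) * mass x \<le> ennreal (1 / s * pp n x) * mass x + ennreal (err n) * mass x"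
      proof (cases "x \<in> {a<..<b}")
        case True
        have "pm n \<le> pp n x + 2 * M n powr (2 * s - 2)" using pp_bd[OF True, of n] by simp
        then have "1 / s * pm n \<le> 1 / s * (pp n x + 2 * M n powr (2 * s - 2))"
          using s_pos by (intro mult_left_mono) auto
        then have "ennreal (1 / s * pm n) \<le> ennreal (1 / s * pp n x + err n)"
          by (intro ennreal_leI) (auto simp: err_def distrib_left)
        also have "\<dots> = ennreal (1 / s * pp n x) + ennreal (err n)"
          using pp0 err0 s_pos by (intro ennreal_plus) auto
        finally show ?thesis unfolding distrib_right[symmetric] by (rule mult_right_mono) simp
      qed (simp add: mass_def)
    qed
    also have "\<dots> = P n + ennreal (err n) * H"
    proof -
      have "(\<integral>\<^sup>+x. ennreal (err n) * mass x \<partial>lborel) = ennreal (err n) * H"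
        unfolding H by (rule nn_integral_cmult) measurable
      moreover have "(\<integral>\<^sup>+x. ennreal (1 / s * pp n x) * mass x + ennreal (err n) * mass x \<partial>lborel) =
         (\<integral>\<^sup>+x. ennreal (1 / s * pp n x) * mass x \<partial>lborel) + (\<integral>\<^sup>+x. ennreal (err n) * mass x \<partial>lborel)"
        by (rule nn_integral_add) measurable
      ultimately show ?thesis unfolding P_eq by simp
    qed
    finally show ?thesis .
  qed
  have upper: "G n \<le> R n + (lam n + ennreal (err n)) * H" for n
  proof -
    have "4 * J n * H + G n \<le> 4 * J n * H + (R n + (lam n + ennreal (err n)) * H)"
    proof -
      have "4 * J n * H + G n = R n + P n" using bal[of n] by (simp add: add.commute)
      also have "\<dots> \<le> R n + (4 * J n + lam n + ennreal (err n)) * H" by (intro add_left_mono P_le)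
      also have "\<dots> = 4 * J n * H + (R n + (lam n + ennreal (err n)) * H)"
        by (simp add: distrib_right distrib_left ac_simps)
      finally show ?thesis .
    qed
    then show ?thesis using JHfin[of n] unfolding ennreal_add_left_cancel_le by blast
  qed
  have lower: "R n + lam n * H \<le> G n + ennreal (err n) * H" for n
  proof -
    have "4 * J n * H + (R n + lam n * H) \<le> 4 * J n * H + (G n + ennreal (err n) * H)"
    proof -
      have "4 * J n * H + (R n + lam n * H) = R n + (4 * J n + lam n) * H" by (simp add: distrib_right distrib_left ac_simps)
      also have "\<dots> \<le> R n + (P n + ennreal (err n) * H)" by (intro add_left_mono P_ge)
      also have "\<dots> = (G n + 4 * J n * H) + ennreal (err n) * H" unfolding bal by (simp add: ac_simps)
      finally show ?thesis by (simp add: ac_simps)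
    qed
    then show ?thesis using JHfin[of n] unfolding ennreal_add_left_cancel_le by blast
  qed
  have G_lim: "G \<longlonglongrightarrow> (gagliardo s u)\<^sup>2"
    unfolding gagliardo_sq G_def M_def by (rule far_integral_tendsto) (auto simp: gagliardo_quotient_def)
  have R_lim: "R \<longlonglongrightarrow> (\<integral>\<^sup>+z. ground_quotient u z \<partial>(lborel \<Otimes>\<^sub>M lborel))"
    unfolding R_def M_def by (rule far_integral_tendsto) (auto simp: ground_quotient_def)
  have profile_lim: "(\<lambda>n. \<integral>\<^sup>+t. ennreal (Lambda_integrand t) * indicator {0<..M n / (M n + 1)} t \<partial>lborel)
      \<longlonglongrightarrow> (\<integral>\<^sup>+t. ennreal (Lambda_integrand t) * indicator {0<..<1} t \<partial>lborel)"
  proof (rule nn_integral_LIMSEQ)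
    have frac: "M n / (M n + 1) \<le> M (Suc n) / (M (Suc n) + 1)" for n
      by (simp add: M_def field_simps)
    show "incseq (\<lambda>n t. ennreal (Lambda_integrand t) * indicator {0<..M n / (M n + 1)} t)"
      using frac by (auto intro!: incseq_SucI le_funI mult_left_mono simp: indicator_def) (meson order_trans)
    fix t :: real
    show "(\<lambda>n. ennreal (Lambda_integrand t) * indicator {0<..M n / (M n + 1)} t) \<longlonglongrightarrow> ennreal (Lambda_integrand t) * indicator {0<..<1} t"
    proof (cases "t \<in> {0<..<1}")
      case True
      obtain N where N: "t / (1 - t) < real N" using reals_Archimedean2 by blast
      have "t \<le> M n / (M n + 1)" if "n \<ge> N" for n
      proof -
        have "t / (1 - t) \<le> M n" using N that by (simp add: M_def)
        then have "t \<le> M n * (1 - t)" using True by (simp add: pos_divide_le_eq)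
        then show ?thesis using M0[of n] by (simp add: field_simps)
      qed
      then have "eventually (\<lambda>n. ennreal (Lambda_integrand t) * indicator {0<..M n / (M n + 1)} t = ennreal (Lambda_integrand t) * indicator {0<..<1} t) sequentially"
        using True by (auto simp: eventually_sequentially indicator_def)
      then show ?thesis by (rule tendsto_eventually)
    next
      case False
      have "M n / (M n + 1) < 1" for n using M0[of n] by (simp add: field_simps)
      then have "t \<notin> {0<..M n / (M n + 1)}" for n
        using False by (auto simp: not_le) (meson less_le_trans not_less order_trans)
      then show ?thesis using False by simp
    qed
  qed auto
  have lam_lim: "lam \<longlonglongrightarrow> ennreal (Lambda s)"
    unfolding lam_def Lambda_eq by (intro tendsto_add tendsto_const ennreal_tendsto_cmult profile_lim) simp
  have err_lim: "(\<lambda>n. ennreal (err n)) \<longlonglongrightarrow> 0"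
  proof -
    have "(\<lambda>n. M n powr (2 * s - 2)) \<longlonglongrightarrow> 0"
      unfolding M_def using s_less_1
      by (intro tendsto_neg_powr filterlim_compose[OF filterlim_real_sequentially filterlim_Suc]) auto
    then have "err \<longlonglongrightarrow> 1 / s * (2 * 0)" unfolding err_def by (intro tendsto_intros)
    then show ?thesis using tendsto_ennrealI by fastforce
  qed
  have Hfin: "H < top" using fin by (simp add: H_def)
  have mulH: "(\<lambda>n. f n * H) \<longlonglongrightarrow> c * H" if "f \<longlonglongrightarrow> c" for f c
    using ennreal_tendsto_cmult[OF Hfin that] by (simp add: mult.commute)
  have "(\<lambda>n. R n + (lam n + ennreal (err n)) * H) \<longlonglongrightarrow>
     (\<integral>\<^sup>+z. ground_quotient u z \<partial>(lborel \<Otimes>\<^sub>M lborel)) + (ennreal (Lambda s) + 0) * H"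
    by (intro tendsto_add mulH R_lim lam_lim err_lim)
  from LIMSEQ_le[OF G_lim this] upper
  have 1: "(gagliardo s u)\<^sup>2 \<le> (\<integral>\<^sup>+z. ground_quotient u z \<partial>(lborel \<Otimes>\<^sub>M lborel)) + ennreal (Lambda s) * H" by auto
  have "(\<lambda>n. G n + ennreal (err n) * H) \<longlonglongrightarrow> (gagliardo s u)\<^sup>2 + 0 * H"
    by (intro tendsto_add mulH G_lim err_lim)
  from LIMSEQ_le[OF _ this, of "\<lambda>n. R n + lam n * H"] lower tendsto_add[OF R_lim mulH[OF lam_lim]]
  have 2: "(\<integral>\<^sup>+z. ground_quotient u z \<partial>(lborel \<Otimes>\<^sub>M lborel)) + ennreal (Lambda s) * H \<le> (gagliardo s u)\<^sup>2" by auto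
  show ?thesis using 1 2 by (auto simp: H_def)
qed

end

section \<open>A smooth bump function\<close>

text \<open>Existence of \<open>n\<close> derivatives, as a recursion that makes the closure properties short inductions.
  The localization to a set allows gluing of a function from a formula on the interval and zero elsewhere.\<close>

primrec times_differentiable_on :: "nat \<Rightarrow> real set \<Rightarrow> (real \<Rightarrow> real) \<Rightarrow> bool" where
  "times_differentiable_on 0 S f = True"
| "times_differentiable_on (Suc n) S f =
     ((\<forall>x\<in>S. f field_differentiable at x) \<and> times_differentiable_on n S (deriv f))"

lemma times_differentiable_on_cong:
  assumes "open S" "\<And>x. x \<in> S \<Longrightarrow> f x = g x" "times_differentiable_on n S f"
  shows "times_differentiable_on n S g"
  using assms(2,3)
proof (induction n arbitrary: f g)
  case (Suc n)
  have ev: "eventually (\<lambda>y. f y = g y) (nhds x)" if "x \<in> S" for x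
    using that \<open>open S\<close> Suc.prems(1) by (auto simp: eventually_nhds)
  have "g field_differentiable at x" if "x \<in> S" for x
  proof -
    have "f field_differentiable at x" using Suc.prems(2) that by simp
    then obtain D where "(f has_field_derivative D) (at x)"
      unfolding field_differentiable_def ..
    then have "(g has_field_derivative D) (at x)"
      using DERIV_cong_ev[OF refl ev[OF that] refl] by simp
    then show ?thesis by (auto simp: field_differentiable_def)
  qed
  moreover have "times_differentiable_on n S (deriv g)"
  proof (rule Suc.IH)
    show "deriv f x = deriv g x" if "x \<in> S" for x
      by (rule deriv_cong_ev[OF ev[OF that] refl])
    show "times_differentiable_on n S (deriv f)" using Suc.prems(2) by simp
  qed
  ultimately show ?case by simp
qed auto

lemma times_differentiable_on_SucI:
  assumes "open S" "\<And>x. x \<in> S \<Longrightarrow> (f has_real_derivative f' x) (at x)" "times_differentiable_on n S f'"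
  shows "times_differentiable_on (Suc n) S f"
proof -
  have "times_differentiable_on n S (deriv f)"
    by (rule times_differentiable_on_cong[OF assms(1) _ assms(3)]) (simp add: DERIV_imp_deriv[OF assms(2)])
  then show ?thesis using assms(2) by (auto simp: field_differentiable_def)
qed

lemma times_differentiable_on_SucD:
  assumes "times_differentiable_on (Suc n) S f"
  shows "times_differentiable_on n S f" "times_differentiable_on n S (deriv f)"
    "\<And>x. x \<in> S \<Longrightarrow> (f has_real_derivative deriv f x) (at x)"
proof -
  show "times_differentiable_on n S f" using assms by (induction n arbitrary: f) auto
qed (use assms in \<open>auto simp: DERIV_deriv_iff_field_differentiable\<close>)

lemma times_differentiable_on_Un:
  "times_differentiable_on n S f \<Longrightarrow> times_differentiable_on n T f \<Longrightarrow> times_differentiable_on n (S \<union> T) f"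
  by (induction n arbitrary: f) auto

lemma times_differentiable_on_const: "times_differentiable_on n S (\<lambda>_. c)"
  by (induction n arbitrary: c) (auto simp: field_differentiable_const)

lemma times_differentiable_on_ident: "open S \<Longrightarrow> times_differentiable_on n S (\<lambda>x. x)"
  by (cases n) (auto intro!: times_differentiable_on_SucI[where f' = "\<lambda>_. 1"] times_differentiable_on_const
      simp del: times_differentiable_on.simps(2))

lemma times_differentiable_on_add:
  "open S \<Longrightarrow> times_differentiable_on n S f \<Longrightarrow> times_differentiable_on n S g \<Longrightarrow>
   times_differentiable_on n S (\<lambda>x. f x + g x)"
proof (induction n arbitrary: f g)
  case (Suc n)
  note f = times_differentiable_on_SucD[OF Suc.prems(2)] and g = times_differentiable_on_SucD[OF Suc.prems(3)]
  show ?case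
    by (rule times_differentiable_on_SucI[where f' = "\<lambda>x. deriv f x + deriv g x"])
      (use Suc.prems(1) f g in \<open>auto intro!: Suc.IH DERIV_add\<close>)
qed auto

lemma times_differentiable_on_mult:
  "open S \<Longrightarrow> times_differentiable_on n S f \<Longrightarrow> times_differentiable_on n S g \<Longrightarrow>
   times_differentiable_on n S (\<lambda>x. f x * g x)"
proof (induction n arbitrary: f g)
  case (Suc n)
  note f = times_differentiable_on_SucD[OF Suc.prems(2)] and g = times_differentiable_on_SucD[OF Suc.prems(3)]
  show ?case
    by (rule times_differentiable_on_SucI[where f' = "\<lambda>x. deriv f x * g x + deriv g x * f x"])
      (use Suc.prems(1) f g in \<open>auto intro!: Suc.IH times_differentiable_on_add DERIV_mult\<close>)
qed auto

lemma times_differentiable_on_compose: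
  "open S \<Longrightarrow> times_differentiable_on n T f \<Longrightarrow> times_differentiable_on n S g \<Longrightarrow> g ` S \<subseteq> T \<Longrightarrow>
   times_differentiable_on n S (\<lambda>x. f (g x))"
proof (induction n arbitrary: f g)
  case (Suc n)
  note f = times_differentiable_on_SucD[OF Suc.prems(2)] and g = times_differentiable_on_SucD[OF Suc.prems(3)]
  show ?case
  proof (rule times_differentiable_on_SucI[where f' = "\<lambda>x. deriv f (g x) * deriv g x"])
    show "((\<lambda>x. f (g x)) has_real_derivative deriv f (g x) * deriv g x) (at x)" if "x \<in> S" for x
      using f(3) g(3) that Suc.prems(4) by (intro DERIV_chain2) auto
    show "times_differentiable_on n S (\<lambda>x. deriv f (g x) * deriv g x)"
      by (intro times_differentiable_on_mult Suc.IH[OF Suc.prems(1) f(2) g(1) Suc.prems(4)] g(2) Suc.prems(1))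
  qed (use Suc.prems in auto)
qed auto

lemma times_differentiable_on_inverse: "times_differentiable_on n {x. x \<noteq> 0} inverse"
proof (induction n)
  case (Suc n)
  have o: "open {x::real. x \<noteq> 0}" by (rule open_Collect_neq) (auto intro: continuous_intros)
  show ?case
  proof (rule times_differentiable_on_SucI[OF o])
    show "(inverse has_real_derivative - 1 * (inverse x * inverse x)) (at x)" if "x \<in> {x. x \<noteq> 0}" for x :: real
      using DERIV_inverse[of x UNIV] that by (simp add: power2_eq_square)
    show "times_differentiable_on n {x. x \<noteq> 0} (\<lambda>x. - 1 * (inverse x * inverse x))"
      by (intro times_differentiable_on_mult times_differentiable_on_const Suc.IH o)
  qed
qed auto

lemma times_differentiable_on_subset:
  "times_differentiable_on n T f \<Longrightarrow> S \<subseteq> T \<Longrightarrow> times_differentiable_on n S f"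
  by (induction n arbitrary: f) auto

lemma times_differentiable_on_ln: "times_differentiable_on n {0<..} ln"
proof (cases n)
  case (Suc m)
  have "times_differentiable_on m {0<..} inverse"
    by (rule times_differentiable_on_subset[OF times_differentiable_on_inverse]) auto
  then show ?thesis unfolding Suc
  proof (rule times_differentiable_on_SucI[rotated 2])
    show "(ln has_real_derivative inverse x) (at x)" if "x \<in> {0<..}" for x :: real
      using that by (intro DERIV_ln) auto
  qed auto
qed auto

lemma times_differentiable_on_powr: "times_differentiable_on n {0<..} (\<lambda>x. x powr c)"
proof (induction n arbitrary: c)
  case (Suc n)
  show ?case
    by (rule times_differentiable_on_SucI[where f' = "\<lambda>x. c * x powr (c - 1)"])
      (auto intro!: has_real_derivative_powr times_differentiable_on_mult times_differentiable_on_const Suc.IH)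
qed auto

lemma times_differentiable_on_iterated_deriv:
  "times_differentiable_on (Suc n) S f \<Longrightarrow> x \<in> S \<Longrightarrow> (deriv ^^ n) f field_differentiable at x"
proof (induction n arbitrary: f)
  case (Suc n)
  then show ?case using Suc.IH[of "deriv f"] by (simp add: funpow_swap1)
qed auto

text \<open>The powers of \<open>1 / x\<close> are included to have a family closed under differentiation
  up to linear combinations.\<close>

definition flat :: "nat \<Rightarrow> real \<Rightarrow> real" where
  "flat k x = (if x > 0 then exp (- (1 / x)) / x ^ k else 0)"

lemma flat_tendsto_0: "(flat k \<longlongrightarrow> 0) (at 0)"
proof -
  have "((\<lambda>x::real. inverse x ^ k / exp (inverse x)) \<longlongrightarrow> 0) (at_right 0)"
    by (rule filterlim_compose[OF tendsto_power_div_exp_0 filterlim_inverse_at_top_right])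
  moreover have "eventually (\<lambda>x. inverse x ^ k / exp (inverse x) = flat k x) (at_right 0)"
    using eventually_at_right_less[of "0::real"]
    by eventually_elim (simp add: flat_def exp_minus field_simps)
  ultimately have r: "(flat k \<longlongrightarrow> 0) (at_right 0)" by (rule Lim_transform_eventually)
  have "eventually (\<lambda>x. flat k x = 0) (at_left 0)"
    using eventually_at_left_real[of "-1" "0::real"] by (simp add: eventually_mono flat_def)
  then have "(flat k \<longlongrightarrow> 0) (at_left 0)" by (rule tendsto_eventually)
  then show ?thesis using r by (simp add: filterlim_split_at)
qed

text \<open>At the origin the difference quotient of \<open>flat k\<close> is \<open>flat (k + 1)\<close>, which tends to 0.\<close>

lemma flat_has_derivative: "(flat k has_real_derivative - real k * flat (k + 1) x + flat (k + 2) x) (at x)"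
proof (cases x "0::real" rule: linorder_cases)
  case less
  have "eventually (\<lambda>y. y < 0) (nhds x)" using eventually_nhds_in_open[of "{..<0}" x] less by simp
  then have "eventually (\<lambda>y. flat k y = 0) (nhds x)" by eventually_elim (simp add: flat_def)
  then show ?thesis using DERIV_cong_ev[OF refl, of "flat k" "\<lambda>_. 0" x 0 0] less by (simp add: flat_def)
next
  case equal
  have "((\<lambda>h. (flat k (0 + h) - flat k 0) / h) \<longlongrightarrow> 0) (at 0)"
  proof (rule Lim_transform_eventually[OF flat_tendsto_0[of "k + 1"]])
    show "eventually (\<lambda>h. flat (k + 1) h = (flat k (0 + h) - flat k 0) / h) (at 0)"
      by (rule always_eventually) (auto simp: flat_def)
  qed
  then show ?thesis unfolding equal by (simp add: DERIV_def flat_def)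
next
  case greater
  have "eventually (\<lambda>y. y \<in> {0<..}) (nhds x)" using greater by (intro eventually_nhds_in_open) auto
  then have ev: "eventually (\<lambda>y. flat k y = exp (- (1 / y)) / y ^ k) (nhds x)"
    by eventually_elim (simp add: flat_def)
  have "((\<lambda>y. exp (- (1 / y)) / y ^ k) has_real_derivative
     (exp (- (1 / x)) * (1 / x\<^sup>2) * x ^ k - exp (- (1 / x)) * (real k * x ^ (k - 1))) / (x ^ k * x ^ k)) (at x)"
    using greater by (auto intro!: derivative_eq_intros simp: power2_eq_square)
  also have "(exp (- (1 / x)) * (1 / x\<^sup>2) * x ^ k - exp (- (1 / x)) * (real k * x ^ (k - 1))) / (x ^ k * x ^ k) =
     - real k * flat (k + 1) x + flat (k + 2) x"
    using greater by (cases k) (simp_all add: flat_def field_simps power2_eq_square)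
  finally show ?thesis using DERIV_cong_ev[OF refl ev refl] by simp
qed

lemma times_differentiable_flat: "times_differentiable_on n UNIV (flat k)"
proof (induction n arbitrary: k)
  case (Suc n)
  show ?case
    by (rule times_differentiable_on_SucI[OF open_UNIV flat_has_derivative])
      (intro times_differentiable_on_add times_differentiable_on_mult times_differentiable_on_const open_UNIV Suc.IH)
qed auto

lemma flat_0_bounds: "0 \<le> flat 0 x" "flat 0 x \<le> 1"
  by (auto simp: flat_def)

lemma flat_0_lipschitz: "\<bar>flat 0 x - flat 0 y\<bar> \<le> 2 * \<bar>x - y\<bar>"
proof -
  have bd: "\<bar>flat 2 z\<bar> \<le> 2" for z
  proof (cases "z > 0")
    case True
    have "(1 / z)\<^sup>2 / 2 \<le> exp (1 / z)"
    proof -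
      have "0 \<le> 1 + 1 / z" using True by simp
      moreover have "1 + 1 / z + (1 / z)\<^sup>2 / 2 \<le> exp (1 / z)"
        using True by (intro exp_lower_Taylor_quadratic) simp
      ultimately show ?thesis by linarith
    qed
    then have "1 / z\<^sup>2 \<le> 2 * exp (1 / z)" by (simp add: power_divide)
    then have "1 / z\<^sup>2 * exp (- (1 / z)) \<le> 2 * exp (1 / z) * exp (- (1 / z))" by (intro mult_right_mono) auto
    also have "\<dots> = 2" by (simp add: exp_minus)
    finally show ?thesis using True by (simp add: flat_def)
  qed (simp add: flat_def)
  have "norm (flat 0 x - flat 0 y) \<le> 2 * norm (x - y)"
  proof (rule field_differentiable_bound[where S = UNIV and f' = "flat 2"])
    show "(flat 0 has_field_derivative flat 2 z) (at z within UNIV)" for z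
      using flat_has_derivative[of 0 z] by (simp add: numeral_2_eq_2)
  qed (use bd in auto)
  then show ?thesis by simp
qed

definition bump :: "real \<Rightarrow> real" where
  "bump x = flat 0 x * flat 0 (1 - x)"

lemma times_differentiable_bump: "times_differentiable_on n UNIV bump"
proof -
  have "times_differentiable_on n UNIV (\<lambda>x. 1 + (- 1) * x)"
    by (intro times_differentiable_on_add times_differentiable_on_mult times_differentiable_on_const
        times_differentiable_on_ident open_UNIV)
  from times_differentiable_on_compose[OF open_UNIV times_differentiable_flat this, of 0]
  have "times_differentiable_on n UNIV (\<lambda>x. flat 0 (1 - x))" by simp
  then show ?thesis unfolding bump_def[abs_def]
    by (intro times_differentiable_on_mult times_differentiable_flat open_UNIV)
qed

lemma bump_eq_0: "x \<notin> {0<..<1} \<Longrightarrow> bump x = 0"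
  by (auto simp: bump_def flat_def)

lemma bump_lipschitz: "\<bar>bump x - bump y\<bar> \<le> 4 * \<bar>x - y\<bar>"
proof -
  have "bump x - bump y = flat 0 x * (flat 0 (1 - x) - flat 0 (1 - y)) + flat 0 (1 - y) * (flat 0 x - flat 0 y)"
    by (simp add: bump_def algebra_simps)
  then have "\<bar>bump x - bump y\<bar> \<le> \<bar>flat 0 x * (flat 0 (1 - x) - flat 0 (1 - y))\<bar> + \<bar>flat 0 (1 - y) * (flat 0 x - flat 0 y)\<bar>"
    by simp
  also have "\<dots> = flat 0 x * \<bar>flat 0 (1 - x) - flat 0 (1 - y)\<bar> + flat 0 (1 - y) * \<bar>flat 0 x - flat 0 y\<bar>"
    by (simp add: abs_mult flat_0_bounds)
  also have "\<dots> \<le> 1 * (2 * \<bar>(1 - x) - (1 - y)\<bar>) + 1 * (2 * \<bar>x - y\<bar>)"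
    by (intro add_mono mult_mono flat_0_lipschitz flat_0_bounds) auto
  finally show ?thesis by (simp add: abs_minus_commute)
qed

lemma bump_ge: "x \<in> {1/4..3/4} \<Longrightarrow> exp (- 8) \<le> bump x"
proof -
  assume x: "x \<in> {1/4..3/4}"
  have "exp (- 4) \<le> flat 0 z" if "z \<ge> 1/4" for z
    using that by (auto simp: flat_def field_simps)
  then have "exp (- 4) * exp (- 4) \<le> bump x"
    unfolding bump_def using x flat_0_bounds by (intro mult_mono) auto
  then show ?thesis by (simp add: exp_add[symmetric])
qed

lemma borel_measurable_bump [measurable]: "bump \<in> borel_measurable borel"
  unfolding bump_def[abs_def] flat_def by measurable

section \<open>Passage to the closure of the test functions\<close>

text \<open>A null set times the line is a null set of the plane. Members of the closure are only
  Lebesgue measurable, and this makes the quotient in the seminorm measurable for them.\<close>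

lemma lebesgue_measurable_fst_snd:
  shows "fst \<in> (lebesgue :: (real \<times> real) measure) \<rightarrow>\<^sub>M (lebesgue :: real measure)"
    and "snd \<in> (lebesgue :: (real \<times> real) measure) \<rightarrow>\<^sub>M (lebesgue :: real measure)"
proof -
  have null: "N \<times> UNIV \<in> null_sets (lborel \<Otimes>\<^sub>M (lborel :: real measure))"
    "UNIV \<times> N \<in> null_sets ((lborel :: real measure) \<Otimes>\<^sub>M lborel)"
    if "N \<in> null_sets (lborel :: real measure)" for N
    using that lborel.emeasure_pair_measure_Times[of N lborel UNIV] lborel.emeasure_pair_measure_Times[of UNIV lborel N]
    by (auto simp: null_sets_def)
  have m: "fst \<in> (lebesgue :: (real \<times> real) measure) \<rightarrow>\<^sub>M (lborel :: real measure)"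
    "snd \<in> (lebesgue :: (real \<times> real) measure) \<rightarrow>\<^sub>M (lborel :: real measure)"
    by (auto intro!: measurable_completion simp: lborel_prod[symmetric])
  show "fst \<in> (lebesgue :: (real \<times> real) measure) \<rightarrow>\<^sub>M (lebesgue :: real measure)"
  proof (rule completion.measurable_completion2[OF m(1)], rule subsetI)
    fix N assume N: "N \<in> null_sets (lborel :: real measure)"
    have "fst -` N = N \<times> (UNIV :: real set)" by auto
    then show "N \<in> null_sets (distr lebesgue lborel (fst :: real \<times> real \<Rightarrow> real))"
      using null(1)[OF N] N
      by (subst null_sets_distr_iff[OF m(1)]) (auto simp: lborel_prod null_sets_def intro!: null_sets_completionI)
  qed
  show "snd \<in> (lebesgue :: (real \<times> real) measure) \<rightarrow>\<^sub>M (lebesgue :: real measure)"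
  proof (rule completion.measurable_completion2[OF m(2)], rule subsetI)
    fix N assume N: "N \<in> null_sets (lborel :: real measure)"
    have "snd -` N = (UNIV :: real set) \<times> N" by auto
    then show "N \<in> null_sets (distr lebesgue lborel (snd :: real \<times> real \<Rightarrow> real))"
      using null(2)[OF N] N
      by (subst null_sets_distr_iff[OF m(2)]) (auto simp: lborel_prod null_sets_def intro!: null_sets_completionI)
  qed
qed

lemma ennreal_linear_combination:
  assumes "0 \<le> c" "0 \<le> x" "0 \<le> d" "0 \<le> y"
  shows "ennreal (c * x + d * y) = ennreal c * ennreal x + ennreal d * ennreal y"
  using assms by (simp add: ennreal_mult)

lemma lebesgue_measurable_ident: "(\<lambda>x. x) \<in> borel_measurable lebesgue"
  by (rule measurable_completion) simp

lemma square_le_weighted_squares: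
  fixes c e \<tau> :: real
  assumes "0 < \<tau>"
  shows "c\<^sup>2 \<le> (1 + \<tau>) * e\<^sup>2 + (1 + 1 / \<tau>) * (e - c)\<^sup>2"
proof -
  have "\<tau> * ((1 + \<tau>) * e\<^sup>2 + (1 + 1 / \<tau>) * (e - c)\<^sup>2 - c\<^sup>2) = (\<tau> * e + (e - c))\<^sup>2"
    using assms by (simp add: field_simps power2_eq_square)
  then have "0 \<le> \<tau> * ((1 + \<tau>) * e\<^sup>2 + (1 + 1 / \<tau>) * (e - c)\<^sup>2 - c\<^sup>2)" by simp
  then show ?thesis using assms by (simp add: zero_le_mult_iff)
qed

context hardy_interval
begin

lemma rho_less_bdist: "x \<in> {a<..<b} \<Longrightarrow> rho x < bdist a b x"
  and inverse_rho: "x \<in> {a<..<b} \<Longrightarrow> 1 / (x - a) + 1 / (b - x) = 1 / rho x"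
proof -
  assume x: "x \<in> {a<..<b}"
  then have pos: "x - a > 0" "b - x > 0" by auto
  have "(x - a) * (b - x) < (x - a) * (b - a)" "(x - a) * (b - x) < (b - x) * (b - a)"
    using pos by (auto simp: mult.commute[of "x - a"])
  then show "rho x < bdist a b x"
    using a_less_b by (auto simp: rho_def bdist_def pos_divide_less_eq)
  show "1 / (x - a) + 1 / (b - x) = 1 / rho x"
    using pos by (simp add: rho_def field_simps)
qed

lemma conformal_mass_eq:
  "(\<integral>\<^sup>+ t\<in>{a<..<b}. ennreal (\<bar>u t\<bar>\<^sup>2 * (1 / (t - a) + 1 / (b - t)) powr (2 * s)) \<partial>lebesgue) = conformal_mass u"
  unfolding conformal_mass_def nn_integral_completion
proof (rule nn_integral_cong)
  fix t
  have "(1 / rho t) powr (2 * s) = rho t powr (- (2 * s))" if "t \<in> {a<..<b}"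
    using rho_pos[OF that] by (simp add: powr_divide powr_minus_divide)
  then show "ennreal (\<bar>u t\<bar>\<^sup>2 * (1 / (t - a) + 1 / (b - t)) powr (2 * s)) * indicator {a<..<b} t =
      ennreal ((u t)\<^sup>2 * rho t powr (- (2 * s))) * indicator {a<..<b} t"
    using inverse_rho[of t] by (auto simp: indicator_def)
qed

text \<open>Strict at every point of the interval; this is the reason why the constant is not attained.\<close>

lemma bdist_weight_less:
  assumes "x \<in> {a<..<b}"
  shows "1 / bdist a b x powr (2 * s) < rho x powr (- (2 * s))"
proof -
  have "rho x powr (2 * s) < bdist a b x powr (2 * s)"
    using rho_pos[OF assms] rho_less_bdist[OF assms] s_pos by (intro powr_less_mono2) auto
  then show ?thesis using rho_pos[OF assms] rho_less_bdist[OF assms]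
    by (simp add: powr_minus_divide divide_strict_left_mono)
qed

lemma hardy_integral_le_conformal_mass: "hardy_integral s a b u \<le> conformal_mass u"
  unfolding hardy_integral_def conformal_mass_def nn_integral_completion
proof (rule nn_integral_mono)
  fix t
  show "ennreal (\<bar>u t\<bar>\<^sup>2 / bdist a b t powr (2 * s)) * indicator {a<..<b} t \<le>
     ennreal ((u t)\<^sup>2 * rho t powr (- (2 * s))) * indicator {a<..<b} t"
  proof (cases "t \<in> {a<..<b}")
    case True
    have "(u t)\<^sup>2 * (1 / bdist a b t powr (2 * s)) \<le> (u t)\<^sup>2 * rho t powr (- (2 * s))"
      using bdist_weight_less[OF True] by (intro mult_left_mono) auto
    then show ?thesis using True by (auto intro!: ennreal_leI)
  qed simp
qed

lemma test_functionD:
  assumes \<phi>: "\<phi> \<in> test_functions a b"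
  shows "\<phi> \<in> borel_measurable borel" and "\<And>x. x \<notin> {a<..<b} \<Longrightarrow> \<phi> x = 0" and "conformal_mass \<phi> < \<infinity>"
proof -
  define K where "K = closure {x. \<phi> x \<noteq> 0}"
  have K: "compact K" "K \<subseteq> {a<..<b}" using \<phi> by (auto simp: test_functions_def K_def)
  have "(deriv ^^ 0) \<phi> field_differentiable at x" for x
    using \<phi> unfolding test_functions_def by blast
  then have "isCont \<phi> x" for x by (simp add: field_differentiable_imp_continuous_at)
  then have cont: "continuous_on UNIV \<phi>" by (simp add: continuous_at_imp_continuous_on)
  then show "\<phi> \<in> borel_measurable borel" by (rule borel_measurable_continuous_onI)
  have off: "\<phi> x = 0" if "x \<notin> K" for x using that closure_subset[of "{x. \<phi> x \<noteq> 0}"] by (auto simp: K_def)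
  then show "\<And>x. x \<notin> {a<..<b} \<Longrightarrow> \<phi> x = 0" using K(2) by blast
  define h where "h x = (\<phi> x)\<^sup>2 * rho x powr (- (2 * s))" for x
  have "rho x \<noteq> 0" if "x \<in> K" for x using rho_pos[of x] that K by force
  moreover have "continuous_on K rho" unfolding rho_def using a_less_b by (intro continuous_intros) auto
  ultimately have "continuous_on K h" unfolding h_def
    by (intro continuous_intros continuous_on_subset[OF cont]) auto
  then have "bounded (h ` K)" using K by (intro compact_imp_bounded compact_continuous_image)
  then obtain C where C: "\<And>x. x \<in> K \<Longrightarrow> \<bar>h x\<bar> \<le> C" by (auto simp: bounded_iff)
  have hC: "h x \<le> max 0 C" for x using C[of x] off[of x] by (cases "x \<in> K") (auto simp: h_def)
  have "conformal_mass \<phi> \<le> (\<integral>\<^sup>+x. ennreal (max 0 C) * indicator {a<..<b} x \<partial>lborel)"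
    unfolding conformal_mass_def
    by (intro nn_integral_mono mult_right_mono ennreal_leI) (use hC in \<open>auto simp: h_def\<close>)
  also have "\<dots> = ennreal (max 0 C) * ennreal (b - a)"
    using a_less_b by (subst nn_integral_cmult_indicator) auto
  also have "\<dots> < \<infinity>" by (simp add: ennreal_mult_less_top)
  finally show "conformal_mass \<phi> < \<infinity>" .
qed

lemma hardy_test_function:
  assumes "\<phi> \<in> test_functions a b"
  shows "ennreal (Lambda s) * conformal_mass \<phi> \<le> (gagliardo s \<phi>)\<^sup>2"
  using ground_state_representation[of \<phi>] test_functionD[OF assms] by simp

lemma gagliardo_sq_lebesgue: "(gagliardo s u)\<^sup>2 = (\<integral>\<^sup>+z. gagliardo_quotient u z \<partial>lebesgue)"
  by (simp add: gagliardo_sq nn_integral_completion lborel_prod)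

lemma lebesgue_measurable_gagliardo_quotient:
  assumes "u \<in> borel_measurable lebesgue"
  shows "gagliardo_quotient u \<in> borel_measurable lebesgue"
proof -
  have [measurable]: "(\<lambda>z. u (fst z)) \<in> borel_measurable (lebesgue :: (real \<times> real) measure)"
    "(\<lambda>z. u (snd z)) \<in> borel_measurable (lebesgue :: (real \<times> real) measure)"
    by (rule measurable_compose[OF lebesgue_measurable_fst_snd(1) assms]
        measurable_compose[OF lebesgue_measurable_fst_snd(2) assms])+
  have [measurable]: "(\<lambda>z. ker (fst z) (snd z)) \<in> borel_measurable (lebesgue :: (real \<times> real) measure)"
    by (intro measurable_completion) (simp add: lborel_prod[symmetric])
  show ?thesis unfolding gagliardo_quotient_def[abs_def] by measurable
qed

lemma gagliardo_sq_perturb: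
  assumes u: "u \<in> borel_measurable lebesgue" and \<phi>: "\<phi> \<in> borel_measurable lebesgue" and \<tau>: "0 < \<tau>"
  shows "(gagliardo s \<phi>)\<^sup>2 \<le> ennreal (1 + \<tau>) * (gagliardo s u)\<^sup>2
     + ennreal (1 + 1 / \<tau>) * (gagliardo s (\<lambda>x. u x - \<phi> x))\<^sup>2"
proof -
  have [measurable]: "gagliardo_quotient u \<in> borel_measurable lebesgue" "gagliardo_quotient (\<lambda>x. u x - \<phi> x) \<in> borel_measurable lebesgue"
    using u \<phi> by (auto intro!: lebesgue_measurable_gagliardo_quotient)
  have "(gagliardo s \<phi>)\<^sup>2 \<le> (\<integral>\<^sup>+z. ennreal (1 + \<tau>) * gagliardo_quotient u z + ennreal (1 + 1 / \<tau>) * gagliardo_quotient (\<lambda>x. u x - \<phi> x) z \<partial>lebesgue)"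
    unfolding gagliardo_sq_lebesgue
  proof (rule nn_integral_mono)
    fix z :: "real \<times> real"
    obtain x y where z: "z = (x, y)" by (cases z)
    have "(\<phi> x - \<phi> y)\<^sup>2 \<le> (1 + \<tau>) * (u x - u y)\<^sup>2 + (1 + 1 / \<tau>) * ((u x - u y) - (\<phi> x - \<phi> y))\<^sup>2"
      by (rule square_le_weighted_squares[OF \<tau>])
    then have "(\<phi> x - \<phi> y)\<^sup>2 * ker x y \<le> ((1 + \<tau>) * (u x - u y)\<^sup>2 + (1 + 1 / \<tau>) * ((u x - u y) - (\<phi> x - \<phi> y))\<^sup>2) * ker x y"
      by (rule mult_right_mono) simp
    also have "\<dots> = (1 + \<tau>) * ((u x - u y)\<^sup>2 * ker x y) + (1 + 1 / \<tau>) * (((u x - \<phi> x) - (u y - \<phi> y))\<^sup>2 * ker x y)"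
    proof -
      have "(u x - u y) - (\<phi> x - \<phi> y) = (u x - \<phi> x) - (u y - \<phi> y)" by simp
      then show ?thesis by (simp only: distrib_right mult.assoc)
    qed
    finally have "ennreal ((\<phi> x - \<phi> y)\<^sup>2 * ker x y) \<le> ennreal ((1 + \<tau>) * ((u x - u y)\<^sup>2 * ker x y) + (1 + 1 / \<tau>) * (((u x - \<phi> x) - (u y - \<phi> y))\<^sup>2 * ker x y))"
      by (rule ennreal_leI)
    also have "\<dots> = ennreal (1 + \<tau>) * ennreal ((u x - u y)\<^sup>2 * ker x y) + ennreal (1 + 1 / \<tau>) * ennreal (((u x - \<phi> x) - (u y - \<phi> y))\<^sup>2 * ker x y)"
      using \<tau> by (intro ennreal_linear_combination) auto
    finally show "gagliardo_quotient \<phi> z \<le> ennreal (1 + \<tau>) * gagliardo_quotient u z + ennreal (1 + 1 / \<tau>) * gagliardo_quotient (\<lambda>x. u x - \<phi> x) z"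
      by (simp add: z gagliardo_quotient_def)
  qed
  also have "\<dots> = (\<integral>\<^sup>+z. ennreal (1 + \<tau>) * gagliardo_quotient u z \<partial>lebesgue) + (\<integral>\<^sup>+z. ennreal (1 + 1 / \<tau>) * gagliardo_quotient (\<lambda>x. u x - \<phi> x) z \<partial>lebesgue)"
    by (rule nn_integral_add) measurable
  also have "(\<integral>\<^sup>+z. ennreal (1 + \<tau>) * gagliardo_quotient u z \<partial>lebesgue) = ennreal (1 + \<tau>) * (gagliardo s u)\<^sup>2"
    unfolding gagliardo_sq_lebesgue by (rule nn_integral_cmult) measurable
  also have "(\<integral>\<^sup>+z. ennreal (1 + 1 / \<tau>) * gagliardo_quotient (\<lambda>x. u x - \<phi> x) z \<partial>lebesgue) =
      ennreal (1 + 1 / \<tau>) * (gagliardo s (\<lambda>x. u x - \<phi> x))\<^sup>2"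
    unfolding gagliardo_sq_lebesgue by (rule nn_integral_cmult) measurable
  finally show ?thesis .
qed

text \<open>The mass over a region on which the weight is bounded, by \<open>k powr (2 s)\<close>. It is therefore
  controlled by the \<open>L2\<close> norm.\<close>

definition inner_mass :: "real \<Rightarrow> (real \<Rightarrow> real) \<Rightarrow> ennreal" where
  "inner_mass k u = (\<integral>\<^sup>+x. ennreal ((u x)\<^sup>2 * rho x powr (- (2 * s))) * indicator {x\<in>{a<..<b}. 1 / k \<le> rho x} x \<partial>lebesgue)"

lemma inner_mass_perturb:
  assumes u[measurable]: "u \<in> borel_measurable lebesgue" and \<phi>[measurable]: "\<phi> \<in> borel_measurable lebesgue"
    and \<tau>: "0 < \<tau>" and k: "0 < k"
  shows "inner_mass k u \<le> ennreal (1 + \<tau>) * conformal_mass \<phi>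
     + ennreal ((1 + 1 / \<tau>) * k powr (2 * s)) * (L2_norm (\<lambda>x. u x - \<phi> x))\<^sup>2"
proof -
  note lebesgue_measurable_ident[measurable]
  have "inner_mass k u \<le> (\<integral>\<^sup>+x. ennreal (1 + \<tau>) * (ennreal ((\<phi> x)\<^sup>2 * rho x powr (- (2 * s))) * indicator {a<..<b} x)
      + ennreal ((1 + 1 / \<tau>) * k powr (2 * s)) * ennreal (\<bar>u x - \<phi> x\<bar>\<^sup>2) \<partial>lebesgue)"
    unfolding inner_mass_def
  proof (rule nn_integral_mono)
    fix x
    show "ennreal ((u x)\<^sup>2 * rho x powr (- (2 * s))) * indicator {x\<in>{a<..<b}. 1 / k \<le> rho x} x \<le>
      ennreal (1 + \<tau>) * (ennreal ((\<phi> x)\<^sup>2 * rho x powr (- (2 * s))) * indicator {a<..<b} x)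
      + ennreal ((1 + 1 / \<tau>) * k powr (2 * s)) * ennreal (\<bar>u x - \<phi> x\<bar>\<^sup>2)"
    proof (cases "x \<in> {a<..<b} \<and> 1 / k \<le> rho x")
      case True
      have "rho x powr (- (2 * s)) \<le> (1 / k) powr (- (2 * s))"
        using True k s_pos by (intro powr_mono2') auto
      also have "\<dots> = k powr (2 * s)" using k by (simp add: powr_divide powr_minus_divide)
      finally have r: "rho x powr (- (2 * s)) \<le> k powr (2 * s)" .
      have "(u x)\<^sup>2 * rho x powr (- (2 * s)) \<le> ((1 + \<tau>) * (\<phi> x)\<^sup>2 + (1 + 1 / \<tau>) * (\<phi> x - u x)\<^sup>2) * rho x powr (- (2 * s))"
        by (intro mult_right_mono square_le_weighted_squares[OF \<tau>]) auto
      also have "\<dots> = (1 + \<tau>) * ((\<phi> x)\<^sup>2 * rho x powr (- (2 * s))) + (1 + 1 / \<tau>) * (\<phi> x - u x)\<^sup>2 * rho x powr (- (2 * s))"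
        by (simp only: distrib_right mult.assoc)
      also have "(1 + 1 / \<tau>) * (\<phi> x - u x)\<^sup>2 * rho x powr (- (2 * s)) \<le> (1 + 1 / \<tau>) * (\<phi> x - u x)\<^sup>2 * k powr (2 * s)"
        using \<tau> by (intro mult_left_mono r) auto
      finally have "ennreal ((u x)\<^sup>2 * rho x powr (- (2 * s))) \<le>
         ennreal ((1 + \<tau>) * ((\<phi> x)\<^sup>2 * rho x powr (- (2 * s))) + ((1 + 1 / \<tau>) * k powr (2 * s)) * \<bar>u x - \<phi> x\<bar>\<^sup>2)"
        by (intro ennreal_leI) (simp add: power2_commute mult_ac)
      also have "\<dots> = ennreal (1 + \<tau>) * ennreal ((\<phi> x)\<^sup>2 * rho x powr (- (2 * s))) + ennreal ((1 + 1 / \<tau>) * k powr (2 * s)) * ennreal (\<bar>u x - \<phi> x\<bar>\<^sup>2)"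
        using \<tau> by (intro ennreal_linear_combination) auto
      finally show ?thesis using True by simp
    qed (auto simp: indicator_def)
  qed
  also have "\<dots> = (\<integral>\<^sup>+x. ennreal (1 + \<tau>) * (ennreal ((\<phi> x)\<^sup>2 * rho x powr (- (2 * s))) * indicator {a<..<b} x) \<partial>lebesgue)
      + (\<integral>\<^sup>+x. ennreal ((1 + 1 / \<tau>) * k powr (2 * s)) * ennreal (\<bar>u x - \<phi> x\<bar>\<^sup>2) \<partial>lebesgue)"
    by (rule nn_integral_add) measurable
  also have "(\<integral>\<^sup>+x. ennreal (1 + \<tau>) * (ennreal ((\<phi> x)\<^sup>2 * rho x powr (- (2 * s))) * indicator {a<..<b} x) \<partial>lebesgue)
      = ennreal (1 + \<tau>) * (\<integral>\<^sup>+x. ennreal ((\<phi> x)\<^sup>2 * rho x powr (- (2 * s))) * indicator {a<..<b} x \<partial>lebesgue)"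
    by (rule nn_integral_cmult) measurable
  also have "(\<integral>\<^sup>+x. ennreal ((\<phi> x)\<^sup>2 * rho x powr (- (2 * s))) * indicator {a<..<b} x \<partial>lebesgue) = conformal_mass \<phi>"
    by (simp add: conformal_mass_def nn_integral_completion)
  also have "(\<integral>\<^sup>+x. ennreal ((1 + 1 / \<tau>) * k powr (2 * s)) * ennreal (\<bar>u x - \<phi> x\<bar>\<^sup>2) \<partial>lebesgue)
      = ennreal ((1 + 1 / \<tau>) * k powr (2 * s)) * (L2_norm (\<lambda>x. u x - \<phi> x))\<^sup>2"
    unfolding L2_norm_def ennreal_sqrt_sq by (rule nn_integral_cmult) measurable
  finally show ?thesis .
qed

text \<open>The inequality for test functions passes to the limit in both sides: the right-hand side is
  continuous for the seminorm, the mass over an inner region is continuous for the \<open>L2\<close> norm,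
  and the inner regions exhaust the interval. The parameter \<open>\<tau>\<close> replaces Minkowski's
  inequality.\<close>

theorem hardy_W_tilde:
  assumes u: "u \<in> W_tilde s a b"
  shows "ennreal (Lambda s) * conformal_mass u \<le> (gagliardo s u)\<^sup>2"
proof -
  have um[measurable]: "u \<in> borel_measurable lebesgue" and Gfin: "gagliardo s u < \<infinity>"
    using u by (auto simp: W_tilde_def W_space_def)
  define G where "G = (gagliardo s u)\<^sup>2"
  have Gfin: "G < top" using Gfin by (simp add: G_def power2_eq_square ennreal_mult_less_top)
  have step1: "ennreal (Lambda s) * inner_mass k u \<le> ennreal ((1 + \<tau>)\<^sup>2) * G" if \<tau>: "0 < \<tau>" and k: "0 < k" for \<tau> k
  proof (rule ennreal_le_epsilon)
    fix e :: real assume e: "0 < e"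
    define K where "K = (1 + 1 / \<tau>) * k powr (2 * s)"
    define E where "E = (1 + \<tau>) * (1 + 1 / \<tau>) + Lambda s * K"
    have K0: "K \<ge> 0" using \<tau> by (simp add: K_def)
    have "(1 + \<tau>) * (1 + 1 / \<tau>) > 0" using \<tau> by (intro mult_pos_pos add_pos_pos) auto
    then have E0: "E > 0" using K0 Lambda_pos unfolding E_def by (intro add_pos_nonneg) auto
    \<comment> \<open>\<open>E\<close> is the total coefficient with which the squared approximation error enters.\<close>
    define \<epsilon> where "\<epsilon> = sqrt (e / E)"
    have \<epsilon>: "\<epsilon> > 0" "E * \<epsilon>\<^sup>2 = e" using e E0 by (auto simp: \<epsilon>_def)
    have "ennreal \<epsilon> > 0" using \<epsilon> by simp
    then obtain \<phi> where \<phi>: "\<phi> \<in> test_functions a b" "W_norm s (\<lambda>x. u x - \<phi> x) < ennreal \<epsilon>"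
      using u unfolding W_tilde_def by blast
    have \<phi>m: "\<phi> \<in> borel_measurable lebesgue" using test_functionD(1)[OF \<phi>(1)] by (intro measurable_completion) simp
    have "L2_norm (\<lambda>x. u x - \<phi> x) \<le> ennreal \<epsilon>" "gagliardo s (\<lambda>x. u x - \<phi> x) \<le> ennreal \<epsilon>"
      by (rule order_trans[OF _ less_imp_le[OF \<phi>(2)]], simp add: W_norm_def)+
    then have small: "(L2_norm (\<lambda>x. u x - \<phi> x))\<^sup>2 \<le> ennreal (\<epsilon>\<^sup>2)" "(gagliardo s (\<lambda>x. u x - \<phi> x))\<^sup>2 \<le> ennreal (\<epsilon>\<^sup>2)"
      using \<epsilon> by (auto simp: ennreal_power[symmetric] intro!: power_mono_ennreal)
    have "ennreal (Lambda s) * inner_mass k u \<le> ennreal (Lambda s) * (ennreal (1 + \<tau>) * conformal_mass \<phi> + ennreal K * ennreal (\<epsilon>\<^sup>2))"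
      by (intro mult_left_mono order_trans[OF inner_mass_perturb[OF um \<phi>m \<tau> k, folded K_def]]
          add_left_mono small(1)) auto
    also have "\<dots> = ennreal (1 + \<tau>) * (ennreal (Lambda s) * conformal_mass \<phi>) + ennreal (Lambda s) * (ennreal K * ennreal (\<epsilon>\<^sup>2))"
      by (simp add: distrib_left mult_ac)
    also have "\<dots> \<le> ennreal (1 + \<tau>) * (ennreal (1 + \<tau>) * G + ennreal (1 + 1 / \<tau>) * ennreal (\<epsilon>\<^sup>2)) + ennreal (Lambda s) * (ennreal K * ennreal (\<epsilon>\<^sup>2))"
    proof (intro add_right_mono mult_left_mono)
      have "ennreal (Lambda s) * conformal_mass \<phi> \<le> (gagliardo s \<phi>)\<^sup>2" by (rule hardy_test_function[OF \<phi>(1)])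
      also have "\<dots> \<le> ennreal (1 + \<tau>) * G + ennreal (1 + 1 / \<tau>) * (gagliardo s (\<lambda>x. u x - \<phi> x))\<^sup>2"
        unfolding G_def by (rule gagliardo_sq_perturb[OF um \<phi>m \<tau>])
      also have "\<dots> \<le> ennreal (1 + \<tau>) * G + ennreal (1 + 1 / \<tau>) * ennreal (\<epsilon>\<^sup>2)"
        by (intro add_left_mono mult_left_mono small(2)) simp
      finally show "ennreal (Lambda s) * conformal_mass \<phi> \<le> \<dots>" .
    qed simp
    also have "\<dots> = (ennreal (1 + \<tau>) * ennreal (1 + \<tau>)) * G +
        (ennreal (1 + \<tau>) * ennreal (1 + 1 / \<tau>) * ennreal (\<epsilon>\<^sup>2) + ennreal (Lambda s) * (ennreal K * ennreal (\<epsilon>\<^sup>2)))"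
      by (simp only: distrib_left mult.assoc add.assoc)
    also have "ennreal (1 + \<tau>) * ennreal (1 + \<tau>) = ennreal ((1 + \<tau>)\<^sup>2)"
      using \<tau> by (subst ennreal_mult[symmetric]) (auto simp: power2_eq_square)
    also have "ennreal (1 + \<tau>) * ennreal (1 + 1 / \<tau>) * ennreal (\<epsilon>\<^sup>2) + ennreal (Lambda s) * (ennreal K * ennreal (\<epsilon>\<^sup>2)) = ennreal e"
    proof -
      have l: "Lambda s \<ge> 0" using Lambda_pos by simp
      have "ennreal (1 + \<tau>) * ennreal (1 + 1 / \<tau>) * ennreal (\<epsilon>\<^sup>2) = ennreal ((1 + \<tau>) * (1 + 1 / \<tau>) * \<epsilon>\<^sup>2)"
        using \<tau> by (subst ennreal_mult[symmetric], simp, simp, subst ennreal_mult[symmetric]) auto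
      moreover have "ennreal (Lambda s) * (ennreal K * ennreal (\<epsilon>\<^sup>2)) = ennreal (Lambda s * (K * \<epsilon>\<^sup>2))"
        using l K0 by (simp add: ennreal_mult)
      moreover have "ennreal ((1 + \<tau>) * (1 + 1 / \<tau>) * \<epsilon>\<^sup>2) + ennreal (Lambda s * (K * \<epsilon>\<^sup>2)) =
          ennreal ((1 + \<tau>) * (1 + 1 / \<tau>) * \<epsilon>\<^sup>2 + Lambda s * (K * \<epsilon>\<^sup>2))"
        using l K0 \<tau> by (intro ennreal_plus[symmetric]) auto
      moreover have "(1 + \<tau>) * (1 + 1 / \<tau>) * \<epsilon>\<^sup>2 + Lambda s * (K * \<epsilon>\<^sup>2) = e"
        unfolding \<epsilon>(2)[symmetric] E_def by (simp only: distrib_right mult.assoc)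
      ultimately show ?thesis by simp
    qed
    finally show "ennreal (Lambda s) * inner_mass k u \<le> ennreal ((1 + \<tau>)\<^sup>2) * G + ennreal e" .
  qed
  have step2: "ennreal (Lambda s) * inner_mass k u \<le> G" if k: "0 < k" for k
  proof (rule LIMSEQ_le_const)
    have "(\<lambda>n. ennreal ((1 + inverse (real (Suc n)))\<^sup>2)) \<longlonglongrightarrow> ennreal ((1 + 0)\<^sup>2)"
      by (intro tendsto_ennrealI tendsto_intros LIMSEQ_inverse_real_of_nat)
    from ennreal_tendsto_cmult[OF Gfin this]
    show "(\<lambda>n. ennreal ((1 + inverse (real (Suc n)))\<^sup>2) * G) \<longlonglongrightarrow> G" by (simp add: mult.commute)
    show "\<exists>N. \<forall>n\<ge>N. ennreal (Lambda s) * inner_mass k u \<le> ennreal ((1 + inverse (real (Suc n)))\<^sup>2) * G"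
      using step1[OF _ k] by simp
  qed
  note lebesgue_measurable_ident[measurable]
  have "(\<lambda>n. inner_mass (real (Suc n)) u) \<longlonglongrightarrow>
      (\<integral>\<^sup>+x. ennreal ((u x)\<^sup>2 * rho x powr (- (2 * s))) * indicator {a<..<b} x \<partial>lebesgue)"
    unfolding inner_mass_def
  proof (rule nn_integral_LIMSEQ)
    have "1 / real (Suc (Suc n)) \<le> 1 / real (Suc n)" for n by (simp add: field_simps)
    then show "incseq (\<lambda>n x. ennreal ((u x)\<^sup>2 * rho x powr (- (2 * s))) * indicator {x\<in>{a<..<b}. 1 / real (Suc n) \<le> rho x} x)"
      by (intro incseq_SucI le_funI mult_left_mono) (auto simp: indicator_def intro: order_trans)
    show "(\<lambda>x. ennreal ((u x)\<^sup>2 * rho x powr (- (2 * s))) * indicator {x\<in>{a<..<b}. 1 / real (Suc n) \<le> rho x} x) \<in> borel_measurable lebesgue" for n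
      by measurable
    fix x
    show "(\<lambda>n. ennreal ((u x)\<^sup>2 * rho x powr (- (2 * s))) * indicator {x\<in>{a<..<b}. 1 / real (Suc n) \<le> rho x} x) \<longlonglongrightarrow>
       ennreal ((u x)\<^sup>2 * rho x powr (- (2 * s))) * indicator {a<..<b} x"
    proof (cases "x \<in> {a<..<b}")
      case True
      obtain N where N: "inverse (real (Suc N)) < rho x" using reals_Archimedean[OF rho_pos[OF True]] by blast
      have "1 / real (Suc n) \<le> rho x" if "n \<ge> N" for n
      proof -
        have "1 / real (Suc n) \<le> 1 / real (Suc N)" using that by (intro divide_left_mono) auto
        then show ?thesis using N by (simp add: inverse_eq_divide)
      qed
      then have "eventually (\<lambda>n. ennreal ((u x)\<^sup>2 * rho x powr (- (2 * s))) * indicator {x\<in>{a<..<b}. 1 / real (Suc n) \<le> rho x} x =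
        ennreal ((u x)\<^sup>2 * rho x powr (- (2 * s))) * indicator {a<..<b} x) sequentially"
        using True by (auto simp: eventually_sequentially indicator_def)
      then show ?thesis by (rule tendsto_eventually)
    next
      case False
      then have "indicator {x\<in>{a<..<b}. 1 / real (Suc n) \<le> rho x} x = (0 :: ennreal)" for n
        by (auto simp: indicator_def)
      then show ?thesis using False by simp
    qed
  qed
  then have "(\<lambda>n. inner_mass (real (Suc n)) u) \<longlonglongrightarrow> conformal_mass u"
    by (simp add: conformal_mass_def nn_integral_completion)
  then have "(\<lambda>n. ennreal (Lambda s) * inner_mass (real (Suc n)) u) \<longlonglongrightarrow> ennreal (Lambda s) * conformal_mass u"
    by (intro ennreal_tendsto_cmult) auto
  then show ?thesis unfolding G_def[symmetric]
    by (rule LIMSEQ_le_const2) (use step2 in auto)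
qed

text \<open>Equality would force the weighted mass to be at most 1, which is the mass for the strictly smaller weight
  built from \<open>bdist\<close>; then \<open>u\<close> vanishes almost everywhere in the interval.\<close>

lemma hardy_strict:
  assumes u: "u \<in> W_tilde s a b" and one: "hardy_integral s a b u = 1" and attained: "(gagliardo s u)\<^sup>2 = ennreal (Lambda s)"
  shows False
proof -
  have [measurable]: "u \<in> borel_measurable lebesgue" using u by (auto simp: W_tilde_def W_space_def)
  note lebesgue_measurable_ident[measurable]
  have [measurable]: "bdist a b \<in> borel_measurable borel"
    unfolding bdist_def[abs_def] by measurable
  define gap where "gap x = ennreal ((u x)\<^sup>2 * (rho x powr (- (2 * s)) - 1 / bdist a b x powr (2 * s))) * indicator {a<..<b} x" for x
  have [measurable]: "gap \<in> borel_measurable lebesgue" unfolding gap_def[abs_def] by measurable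
  have weight_m: "(\<lambda>x. ennreal (\<bar>u x\<bar>\<^sup>2 / bdist a b x powr (2 * s)) * indicator {a<..<b} x) \<in> borel_measurable lebesgue"
    by measurable
  have "ennreal (Lambda s) * conformal_mass u \<le> ennreal (Lambda s) * 1"
    using hardy_W_tilde[OF u] attained by simp
  then have le1: "conformal_mass u \<le> 1" using Lambda_pos by (subst (asm) ennreal_mult_le_mult_iff) auto
  have "conformal_mass u = (\<integral>\<^sup>+x. gap x + ennreal (\<bar>u x\<bar>\<^sup>2 / bdist a b x powr (2 * s)) * indicator {a<..<b} x \<partial>lebesgue)"
    unfolding conformal_mass_def nn_integral_completion
  proof (rule nn_integral_cong)
    fix x
    show "ennreal ((u x)\<^sup>2 * rho x powr (- (2 * s))) * indicator {a<..<b} x =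
      gap x + ennreal (\<bar>u x\<bar>\<^sup>2 / bdist a b x powr (2 * s)) * indicator {a<..<b} x"
    proof (cases "x \<in> {a<..<b}")
      case True
      have "(u x)\<^sup>2 * rho x powr (- (2 * s)) = (u x)\<^sup>2 * (rho x powr (- (2 * s)) - 1 / bdist a b x powr (2 * s)) + \<bar>u x\<bar>\<^sup>2 / bdist a b x powr (2 * s)"
        by (simp add: right_diff_distrib)
      then show ?thesis using bdist_weight_less[OF True] True
        by (simp add: gap_def ennreal_plus[symmetric] del: ennreal_plus)
    qed (simp add: gap_def)
  qed
  also have "\<dots> = (\<integral>\<^sup>+x. gap x \<partial>lebesgue) + hardy_integral s a b u"
    unfolding hardy_integral_def by (rule nn_integral_add) measurable
  finally have "1 + (\<integral>\<^sup>+x. gap x \<partial>lebesgue) \<le> 1 + 0" using le1 one by (simp add: add.commute)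
  then have "(\<integral>\<^sup>+x. gap x \<partial>lebesgue) = 0" unfolding ennreal_add_left_cancel_le by auto
  then have "AE x in lebesgue. gap x = 0" by (subst (asm) nn_integral_0_iff_AE) measurable
  then have "AE x in lebesgue. ennreal (\<bar>u x\<bar>\<^sup>2 / bdist a b x powr (2 * s)) * indicator {a<..<b} x = 0"
  proof eventually_elim
    fix x assume g: "gap x = 0"
    show "ennreal (\<bar>u x\<bar>\<^sup>2 / bdist a b x powr (2 * s)) * indicator {a<..<b} x = 0"
    proof (cases "x \<in> {a<..<b}")
      case True
      then have "(u x)\<^sup>2 * (rho x powr (- (2 * s)) - 1 / bdist a b x powr (2 * s)) \<le> 0"
        using g by (simp add: gap_def ennreal_eq_0_iff)
      then have "(u x)\<^sup>2 \<le> 0" using bdist_weight_less[OF True] by (simp add: mult_le_0_iff)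
      then show ?thesis by simp
    qed simp
  qed
  then have "hardy_integral s a b u = 0" unfolding hardy_integral_def
    by (simp only: nn_integral_0_iff_AE[OF weight_m])
  then show False using one by simp
qed

end

section \<open>Trial functions near an end point\<close>

context hardy_interval
begin

definition logit :: "real \<Rightarrow> real" where
  "logit x = ln (odds x)"

definition expit :: "real \<Rightarrow> real" where
  "expit r = b - (b - a) / (1 + exp r)"

lemma odds_pos: "x \<in> {a<..<b} \<Longrightarrow> 0 < odds x"
  by (simp add: odds_def)

lemma one_plus_exp_pos: "0 < 1 + exp (r :: real)"
  by (simp add: add_pos_pos)

lemma expit_in: "expit r \<in> {a<..<b}"
proof -
  have "0 < (b - a) / (1 + exp r)" using a_less_b one_plus_exp_pos[of r] by simp
  moreover have "(b - a) / (1 + exp r) < b - a"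
    using a_less_b one_plus_exp_pos[of r] by (simp add: pos_divide_less_eq distrib_left)
  ultimately show ?thesis by (simp add: expit_def)
qed

lemma expit_logit: "x \<in> {a<..<b} \<Longrightarrow> expit (logit x) = x"
proof -
  assume x: "x \<in> {a<..<b}"
  have "1 + exp (logit x) = (b - a) / (b - x)"
    using odds_pos[OF x] x by (simp add: logit_def odds_def field_simps)
  then show ?thesis using x a_less_b by (simp add: expit_def)
qed

lemma logit_expit: "logit (expit r) = r"
proof -
  have "expit r - a = (b - a) / (1 + exp r) * exp r"
    using one_plus_exp_pos[of r] by (simp add: expit_def field_simps)
  moreover have "b - expit r = (b - a) / (1 + exp r)" by (simp add: expit_def)
  moreover have "(b - a) / (1 + exp r) \<noteq> 0" using a_less_b one_plus_exp_pos[of r] by simp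
  ultimately have "odds (expit r) = exp r" unfolding odds_def by simp
  then show ?thesis by (simp add: logit_def)
qed

lemma strict_mono_expit: "strict_mono expit"
proof (rule strict_monoI)
  fix p q :: real assume "p < q"
  then show "expit p < expit q"
    using a_less_b one_plus_exp_pos[of p] one_plus_exp_pos[of q]
    by (simp add: expit_def divide_strict_left_mono)
qed

lemma logit_bounds_iff:
  assumes "x \<in> {a<..<b}"
  shows "logit x \<in> {p..q} \<longleftrightarrow> x \<in> {expit p..expit q}"
  using strict_mono_less_eq[OF strict_mono_expit, of p "logit x"]
    strict_mono_less_eq[OF strict_mono_expit, of "logit x" q]
  by (simp add: expit_logit[OF assms])

lemma logit_has_derivative:
  assumes x: "x \<in> {a<..<b}"
  shows "(logit has_real_derivative 1 / rho x) (at x)"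
proof -
  have pos: "x - a > 0" "b - x > 0" using x by auto
  have "(odds has_real_derivative (b - a) / (b - x)\<^sup>2) (at x)"
    unfolding odds_def[abs_def] using pos
    by (auto intro!: derivative_eq_intros simp: power2_eq_square)
  from DERIV_chain2[OF DERIV_ln[OF odds_pos[OF x]] this]
  have "(logit has_real_derivative inverse (odds x) * ((b - a) / (b - x)\<^sup>2)) (at x)"
    unfolding logit_def[abs_def] .
  also have "inverse (odds x) * ((b - a) / (b - x)\<^sup>2) = 1 / rho x"
    using pos a_less_b by (simp add: odds_def rho_def power2_eq_square)
  finally show ?thesis .
qed

lemma integral_inverse_rho:
  assumes "p \<le> q"
  shows "(\<integral>\<^sup>+x. ennreal (1 / rho x) * indicator {expit p..expit q} x \<partial>lborel) = ennreal (q - p)"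
proof -
  have sub: "x \<in> {a<..<b}" if "x \<in> {expit p..expit q}" for x
    using that expit_in[of p] expit_in[of q] by auto
  have "(\<integral>\<^sup>+x. ennreal (1 / rho x) * indicator {expit p..expit q} x \<partial>lborel) = ennreal (logit (expit q) - logit (expit p))"
  proof (rule nn_integral_FTC_Icc)
    show "(logit has_real_derivative 1 / rho x) (at x)" if "x \<in> {expit p..expit q}" for x
      by (rule logit_has_derivative[OF sub[OF that]])
    show "0 \<le> 1 / rho x" if "x \<in> {expit p..expit q}" for x
      using rho_pos[OF sub[OF that]] by simp
    show "expit p \<le> expit q" using assms strict_mono_less_eq[OF strict_mono_expit] by simp
  qed measurable
  then show ?thesis by (simp add: logit_expit)
qed

text \<open>In the coordinate \<open>logit\<close> the trial function is the ground state times a bump stretched over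
  \<open>{- 2 N..- N}\<close>. Stretching lowers the remainder of the ground state representation; the shift towards the
  end point \<open>a\<close> makes \<open>bdist\<close> and \<open>rho\<close> comparable with a ratio close to 1.\<close>

definition trial :: "real \<Rightarrow> real \<Rightarrow> real" where
  "trial N x = (if x \<in> {a<..<b} then ground x * bump (- (logit x / N) - 1) else 0)"

lemma borel_measurable_trial [measurable]: "trial N \<in> borel_measurable borel"
  unfolding trial_def[abs_def] logit_def by measurable

lemma trial_support:
  assumes N: "0 < N" and x: "trial N x \<noteq> 0"
  shows "x \<in> {expit (- (2 * N))..expit (- N)}"
proof -
  have xi: "x \<in> {a<..<b}" using x by (auto simp: trial_def split: if_splits)
  have "bump (- (logit x / N) - 1) \<noteq> 0" using x xi by (auto simp: trial_def)
  then have "- (logit x / N) - 1 \<in> {0<..<1}" using bump_eq_0 by blast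
  then have "logit x / N < - 1" "- 2 < logit x / N" by auto
  then have "logit x \<in> {- (2 * N)..- N}"
    using N by (simp add: pos_divide_less_eq pos_less_divide_eq)
  then show ?thesis using logit_bounds_iff[OF xi] by blast
qed

lemma times_differentiable_trial:
  assumes N: "0 < N"
  shows "times_differentiable_on n UNIV (trial N)"
proof -
  define S where "S = {expit (- (2 * N))..expit (- N)}"
  have S: "S \<subseteq> {a<..<b}" unfolding S_def using expit_in[of "- (2 * N)"] expit_in[of "- N"] by auto
  let ?I = "{a<..<b}"
  have oI: "open ?I" by simp
  note cl = times_differentiable_on_add[OF oI] times_differentiable_on_mult[OF oI]
    times_differentiable_on_const times_differentiable_on_ident[OF oI]
  have lin1: "times_differentiable_on n ?I (\<lambda>x. x + (- a))" and lin2: "times_differentiable_on n ?I (\<lambda>x. b + (- 1) * x)"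
    by (intro cl)+
  have "times_differentiable_on n ?I (\<lambda>x. inverse (b + (- 1) * x))"
    by (rule times_differentiable_on_compose[OF oI times_differentiable_on_inverse lin2]) auto
  with lin1 have "times_differentiable_on n ?I (\<lambda>x. (x + (- a)) * inverse (b + (- 1) * x))" by (intro cl)
  then have odds: "times_differentiable_on n ?I odds"
    by (rule times_differentiable_on_cong[OF oI, rotated]) (simp add: odds_def divide_inverse)
  have logit: "times_differentiable_on n ?I logit" unfolding logit_def[abs_def]
    by (rule times_differentiable_on_compose[OF oI times_differentiable_on_ln odds]) (use odds_pos in auto)
  have "times_differentiable_on n ?I (\<lambda>x. ((x + (- a)) * (b + (- 1) * x)) * inverse (b - a))"
    using lin1 lin2 by (intro cl)
  then have rho: "times_differentiable_on n ?I rho"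
    by (rule times_differentiable_on_cong[OF oI, rotated]) (simp add: rho_def divide_inverse)
  have ground: "times_differentiable_on n ?I ground" unfolding ground_def[abs_def]
    by (rule times_differentiable_on_compose[OF oI times_differentiable_on_powr rho]) (use rho_pos in auto)
  have "times_differentiable_on n ?I (\<lambda>x. (- 1 / N) * logit x + (- 1))" using logit by (intro cl)
  from times_differentiable_on_compose[OF oI times_differentiable_bump this]
  have "times_differentiable_on n ?I (\<lambda>x. bump ((- 1 / N) * logit x + (- 1)))" by simp
  with ground have "times_differentiable_on n ?I (\<lambda>x. ground x * bump ((- 1 / N) * logit x + (- 1)))" by (intro cl)
  then have inside: "times_differentiable_on n ?I (trial N)"
    by (rule times_differentiable_on_cong[OF oI, rotated]) (simp add: trial_def)
  have "open (- S)" by (simp add: S_def open_Compl)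
  then have outside: "times_differentiable_on n (- S) (trial N)"
    by (rule times_differentiable_on_cong[OF _ _ times_differentiable_on_const[of n _ 0]])
      (use trial_support[OF N] in \<open>auto simp: S_def\<close>)
  have "?I \<union> - S = UNIV" using S by auto
  then show ?thesis using times_differentiable_on_Un[OF inside outside] by simp
qed

lemma test_functions_trial:
  assumes N: "0 < N"
  shows "(\<lambda>x. c * trial N x) \<in> test_functions a b"
proof -
  define S where "S = {expit (- (2 * N))..expit (- N)}"
  have S: "S \<subseteq> {a<..<b}" unfolding S_def using expit_in[of "- (2 * N)"] expit_in[of "- N"] by auto
  have "{x. c * trial N x \<noteq> 0} \<subseteq> S" using trial_support[OF N] by (auto simp: S_def)
  moreover have "closed S" "compact S" by (auto simp: S_def)
  ultimately have cl: "closure {x. c * trial N x \<noteq> 0} \<subseteq> S" by (intro closure_minimal) auto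
  then have "compact (closure {x. c * trial N x \<noteq> 0})"
    using \<open>compact S\<close> by (meson bounded_subset compact_eq_bounded_closed closed_closure)
  moreover have "(deriv ^^ n) (\<lambda>x. c * trial N x) field_differentiable at x" for n x
    by (rule times_differentiable_on_iterated_deriv[of n UNIV])
      (intro times_differentiable_on_mult times_differentiable_on_const times_differentiable_trial N open_UNIV, simp)
  ultimately show ?thesis using cl S by (auto simp: test_functions_def)
qed

lemma trial_ratio: "x \<in> {a<..<b} \<Longrightarrow> trial N x / ground x = bump (- (logit x / N) - 1)"
  using ground_pos[of x] by (simp add: trial_def)

text \<open>On the middle half of its support the bump is at least \<open>exp (- 8)\<close>, and that half has length
  \<open>N / 2\<close> for the invariant measure.\<close>

lemma conformal_mass_trial_ge:
  assumes N: "0 < N"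
  shows "ennreal (exp (- 16) * (N / 2)) \<le> conformal_mass (trial N)"
proof -
  define S where "S = {expit (- (7 / 4 * N))..expit (- (5 / 4 * N))}"
  have S: "S \<subseteq> {a<..<b}" unfolding S_def using expit_in[of "- (7 / 4 * N)"] expit_in[of "- (5 / 4 * N)"] by auto
  have "ennreal (exp (- 16) * (N / 2)) = ennreal (exp (- 16)) * (\<integral>\<^sup>+x. ennreal (1 / rho x) * indicator S x \<partial>lborel)"
    unfolding S_def using N by (subst integral_inverse_rho) (auto simp: ennreal_mult[symmetric])
  also have "\<dots> = (\<integral>\<^sup>+x. ennreal (exp (- 16)) * (ennreal (1 / rho x) * indicator S x) \<partial>lborel)"
    unfolding S_def by (rule nn_integral_cmult[symmetric]) measurable
  also have "\<dots> \<le> conformal_mass (trial N)" unfolding conformal_mass_def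
  proof (rule nn_integral_mono)
    fix x
    show "ennreal (exp (- 16)) * (ennreal (1 / rho x) * indicator S x) \<le> ennreal ((trial N x)\<^sup>2 * rho x powr (- (2 * s))) * indicator {a<..<b} x"
    proof (cases "x \<in> S")
      case True
      then have x: "x \<in> {a<..<b}" using S by auto
      have "logit x \<in> {- (7 / 4 * N)..- (5 / 4 * N)}"
        using True logit_bounds_iff[OF x] unfolding S_def by blast
      then have "- (logit x / N) - 1 \<in> {1/4..3/4}"
        using N by (auto simp: field_simps)
      then have "exp (- 8) \<le> bump (- (logit x / N) - 1)" by (rule bump_ge)
      then have "(exp (- 8))\<^sup>2 \<le> (bump (- (logit x / N) - 1))\<^sup>2" by (intro power_mono) auto
      then have "exp (- 16) * (1 / rho x) \<le> (bump (- (logit x / N) - 1))\<^sup>2 * (1 / rho x)"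
        using rho_pos[OF x] by (intro mult_right_mono) (auto simp: power2_eq_square exp_add[symmetric])
      also have "\<dots> = (trial N x)\<^sup>2 * rho x powr (- (2 * s))"
        by (simp add: mass_density_ratio[OF x] trial_ratio[OF x])
      finally have "ennreal (exp (- 16) * (1 / rho x)) \<le> ennreal ((trial N x)\<^sup>2 * rho x powr (- (2 * s)))"
        by (rule ennreal_leI)
      then show ?thesis using True x rho_pos[OF x] by (simp add: ennreal_mult[symmetric])
    qed simp
  qed
  finally show ?thesis .
qed

lemma ln_cross_ratio_sq:
  assumes "x \<in> {a<..<b}" "y \<in> {a<..<b}"
  shows "(ln (cross_ratio x y))\<^sup>2 = (logit x - logit y)\<^sup>2"
  using odds_pos[OF assms(1)] odds_pos[OF assms(2)]
  by (auto simp: cross_ratio_def logit_def ln_div power2_commute)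

text \<open>The stretched bump is Lipschitz with constant \<open>4 / N\<close> in \<open>logit\<close>, and \<open>logit x - logit y\<close> is
  the logarithm of the cross ratio up to sign. A difference of values is nonzero only if one of the points lies in the
  support, which has invariant length \<open>N\<close>; this gives \<open>2 * (16 / N\<^sup>2) * 2 * N\<close> times the integral of the squared
  logarithm.\<close>

lemma ground_energy_trial_le:
  assumes N: "0 < N"
  shows "(\<integral>\<^sup>+z. ground_quotient (trial N) z \<partial>(lborel \<Otimes>\<^sub>M lborel)) \<le> ennreal (64 / N) * mellin (\<lambda>t. ennreal ((ln t)\<^sup>2))"
proof -
  define S where "S = {expit (- (2 * N))..expit (- N)}"
  have S: "S \<subseteq> {a<..<b}" unfolding S_def using expit_in[of "- (2 * N)"] expit_in[of "- N"] by auto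
  define J where "J = mellin (\<lambda>t. ennreal ((ln t)\<^sup>2))"
  define k where "k x y = (\<lambda>t. ennreal ((ln t)\<^sup>2)) (cross_ratio x y) * ennreal (ground x * ground y * ker x y) * indicator {a<..<b} y" for x y
  define F where "F z = ennreal (16 / N\<^sup>2) * (indicator S (fst z) * k (fst z) (snd z))" for z
  have [measurable]: "(\<lambda>z. k (fst z) (snd z)) \<in> borel_measurable (lborel \<Otimes>\<^sub>M lborel)" unfolding k_def by measurable
  have [measurable]: "F \<in> borel_measurable (lborel \<Otimes>\<^sub>M lborel)" unfolding F_def[abs_def] S_def by measurable
  have "(\<integral>\<^sup>+z. ground_quotient (trial N) z \<partial>(lborel \<Otimes>\<^sub>M lborel)) \<le> (\<integral>\<^sup>+z. F z + F (snd z, fst z) \<partial>(lborel \<Otimes>\<^sub>M lborel))"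
  proof (rule nn_integral_mono)
    fix z :: "real \<times> real"
    obtain x y where z: "z = (x, y)" by (cases z)
    show "ground_quotient (trial N) z \<le> F z + F (snd z, fst z)"
    proof (cases "x \<in> {a<..<b} \<and> y \<in> {a<..<b} \<and> (x \<in> S \<or> y \<in> S)")
      case True
      then have x: "x \<in> {a<..<b}" and y: "y \<in> {a<..<b}" by auto
      define B where "B = ennreal (16 / N\<^sup>2) * (ennreal ((logit x - logit y)\<^sup>2) * ennreal (ground x * ground y * ker x y))"
      have w: "0 \<le> ground x * ground y * ker x y" using ground_pos[OF x] ground_pos[OF y] by simp
      have "\<bar>bump (- (logit x / N) - 1) - bump (- (logit y / N) - 1)\<bar> \<le> 4 * \<bar>(- (logit x / N) - 1) - (- (logit y / N) - 1)\<bar>"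
        by (rule bump_lipschitz)
      also have "\<dots> = 4 / N * \<bar>logit x - logit y\<bar>"
      proof -
        have "(- (logit x / N) - 1) - (- (logit y / N) - 1) = - ((logit x - logit y) / N)" by (simp add: diff_divide_distrib)
        then show ?thesis using N by (simp only: abs_minus_cancel abs_divide) simp
      qed
      finally have "\<bar>bump (- (logit x / N) - 1) - bump (- (logit y / N) - 1)\<bar>\<^sup>2 \<le> (4 / N * \<bar>logit x - logit y\<bar>)\<^sup>2"
        by (intro power_mono) auto
      then have "(trial N x / ground x - trial N y / ground y)\<^sup>2 \<le> 16 / N\<^sup>2 * (logit x - logit y)\<^sup>2"
        by (simp add: trial_ratio[OF x] trial_ratio[OF y] power_mult_distrib power_divide)
      then have "ground x * ground y * ker x y * (trial N x / ground x - trial N y / ground y)\<^sup>2 \<le> ground x * ground y * ker x y * (16 / N\<^sup>2 * (logit x - logit y)\<^sup>2)"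
        using w by (rule mult_left_mono)
      then have "ground_quotient (trial N) z \<le> ennreal (16 / N\<^sup>2 * ((logit x - logit y)\<^sup>2 * (ground x * ground y * ker x y)))"
        using x y unfolding ground_quotient_def z by (auto intro!: ennreal_leI simp: mult_ac)
      also have "\<dots> = B"
      proof -
        have "ennreal (16 / N\<^sup>2 * ((logit x - logit y)\<^sup>2 * (ground x * ground y * ker x y))) =
           ennreal (16 / N\<^sup>2) * ennreal ((logit x - logit y)\<^sup>2 * (ground x * ground y * ker x y))"
          using w by (intro ennreal_mult) auto
        also have "ennreal ((logit x - logit y)\<^sup>2 * (ground x * ground y * ker x y)) = ennreal ((logit x - logit y)\<^sup>2) * ennreal (ground x * ground y * ker x y)"
          using w by (intro ennreal_mult) auto
        finally show ?thesis by (simp add: B_def)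
      qed
      also have "\<dots> \<le> F z + F (snd z, fst z)"
      proof (cases "x \<in> S")
        case True
        then have "F z = B" using y by (simp add: F_def k_def z B_def ln_cross_ratio_sq[OF x y])
        then show ?thesis by simp
      next
        case False
        then have "y \<in> S" using True by auto
        then have "F (snd z, fst z) = B" using x
          by (simp add: F_def k_def z B_def ln_cross_ratio_sq[OF y x] power2_commute[of "logit y"] ker_commute[of y x] mult.commute[of "ground y"])
        then show ?thesis by simp
      qed
      finally show ?thesis .
    next
      case False
      then have "(x \<notin> {a<..<b} \<or> y \<notin> {a<..<b}) \<or> (trial N x = 0 \<and> trial N y = 0)"
        using trial_support[OF N, of x] trial_support[OF N, of y] unfolding S_def by blast
      then have "ground_quotient (trial N) z = 0" by (auto simp: ground_quotient_def z)
      then show ?thesis by simp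
    qed
  qed
  also have "\<dots> = 2 * (\<integral>\<^sup>+x. \<integral>\<^sup>+y. F (x, y) \<partial>lborel \<partial>lborel)" by (rule nn_integral_plane_symmetrize) measurable
  also have "(\<integral>\<^sup>+x. \<integral>\<^sup>+y. F (x, y) \<partial>lborel \<partial>lborel) = (\<integral>\<^sup>+x. ennreal (16 / N\<^sup>2) * 2 * J * (ennreal (1 / rho x) * indicator S x) \<partial>lborel)"
  proof (rule nn_integral_cong)
    fix x
    show "(\<integral>\<^sup>+y. F (x, y) \<partial>lborel) = ennreal (16 / N\<^sup>2) * 2 * J * (ennreal (1 / rho x) * indicator S x)"
    proof (cases "x \<in> S")
      case True
      then have x: "x \<in> {a<..<b}" using S by auto
      have [measurable]: "(\<lambda>y. k x y) \<in> borel_measurable borel" unfolding k_def by measurable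
      have "(\<integral>\<^sup>+y. F (x, y) \<partial>lborel) = (\<integral>\<^sup>+y. ennreal (16 / N\<^sup>2) * k x y \<partial>lborel)"
        using True by (simp add: F_def)
      also have "\<dots> = ennreal (16 / N\<^sup>2) * (\<integral>\<^sup>+y. k x y \<partial>lborel)" by (rule nn_integral_cmult) measurable
      also have "(\<integral>\<^sup>+y. k x y \<partial>lborel) = 2 * (ennreal (1 / rho x) * J)"
        unfolding k_def J_def by (rule conformal_kernel_integral[OF x]) measurable
      finally show ?thesis using True by (simp add: mult_ac)
    qed (simp add: F_def)
  qed
  also have "\<dots> = ennreal (16 / N\<^sup>2) * 2 * J * (\<integral>\<^sup>+x. ennreal (1 / rho x) * indicator S x \<partial>lborel)"
    unfolding S_def by (rule nn_integral_cmult) measurable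
  also have "(\<integral>\<^sup>+x. ennreal (1 / rho x) * indicator S x \<partial>lborel) = ennreal N"
    unfolding S_def using N by (subst integral_inverse_rho) auto
  also have "2 * (ennreal (16 / N\<^sup>2) * 2 * J * ennreal N) = (4 * (ennreal (16 / N\<^sup>2) * ennreal N)) * J"
    by (simp add: mult_ac)
  also have "4 * (ennreal (16 / N\<^sup>2) * ennreal N) = ennreal (64 / N)"
  proof -
    have "4 * (ennreal (16 / N\<^sup>2) * ennreal N) = ennreal 4 * ennreal (16 / N\<^sup>2 * N)"
      using N by (subst ennreal_mult) auto
    also have "\<dots> = ennreal (4 * (16 / N\<^sup>2 * N))" using N by (intro ennreal_mult[symmetric]) auto
    also have "4 * (16 / N\<^sup>2 * N) = 64 / N" using N by (simp add: power2_eq_square)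
    finally show ?thesis .
  qed
  finally show ?thesis unfolding J_def .
qed

text \<open>Near \<open>a\<close> one has \<open>bdist x \<le> x - a = rho x * (1 + odds x)\<close>, and \<open>odds x \<le> exp (- N)\<close> on the
  support.\<close>

lemma hardy_integral_trial_ge:
  assumes N: "0 < N"
  shows "conformal_mass (trial N) \<le> ennreal ((1 + exp (- N)) powr (2 * s)) * hardy_integral s a b (trial N)"
proof -
  define C where "C = (1 + exp (- N)) powr (2 * s)"
  have [measurable]: "bdist a b \<in> borel_measurable borel" unfolding bdist_def[abs_def] by measurable
  have "conformal_mass (trial N) \<le> (\<integral>\<^sup>+x. ennreal C * (ennreal (\<bar>trial N x\<bar>\<^sup>2 / bdist a b x powr (2 * s)) * indicator {a<..<b} x) \<partial>lborel)"
    unfolding conformal_mass_def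
  proof (rule nn_integral_mono)
    fix x
    show "ennreal ((trial N x)\<^sup>2 * rho x powr (- (2 * s))) * indicator {a<..<b} x \<le>
      ennreal C * (ennreal (\<bar>trial N x\<bar>\<^sup>2 / bdist a b x powr (2 * s)) * indicator {a<..<b} x)"
    proof (cases "trial N x = 0")
      case False
      then have xS: "x \<in> {expit (- (2 * N))..expit (- N)}" by (rule trial_support[OF N])
      then have x: "x \<in> {a<..<b}" using expit_in[of "- (2 * N)"] expit_in[of "- N"] by auto
      have "logit x \<le> - N" using logit_bounds_iff[OF x] xS by (meson atLeastAtMost_iff)
      then have o: "odds x \<le> exp (- N)" 
      using odds_pos[OF x] exp_le_cancel_iff[of "logit x" "- N"] by (simp add: logit_def)
      have xa: "x - a > 0" "b - x > 0" using x by auto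
      have r0: "rho x > 0" by (rule rho_pos[OF x])
      have d0: "bdist a b x > 0" using rho_less_bdist[OF x] r0 by simp
      have "bdist a b x \<le> x - a" by (simp add: bdist_def)
      also have "x - a = rho x * (1 + odds x)"
      proof -
        have "1 + odds x = (b - a) / (b - x)" using xa by (simp add: odds_def field_simps)
        then show ?thesis using xa a_less_b by (simp add: rho_def)
      qed
      also have "\<dots> \<le> rho x * (1 + exp (- N))" using o r0 by (intro mult_left_mono) auto
      finally have "bdist a b x powr (2 * s) \<le> (rho x * (1 + exp (- N))) powr (2 * s)"
        using d0 s_pos by (intro powr_mono2) auto
      also have "\<dots> = rho x powr (2 * s) * C" using r0 by (simp add: powr_mult C_def)
      finally have "rho x powr (- (2 * s)) \<le> C / bdist a b x powr (2 * s)"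
        using r0 d0 by (simp add: powr_minus_divide field_simps)
      then have "(trial N x)\<^sup>2 * rho x powr (- (2 * s)) \<le> (trial N x)\<^sup>2 * (C / bdist a b x powr (2 * s))"
        by (intro mult_left_mono) auto
      then have "ennreal ((trial N x)\<^sup>2 * rho x powr (- (2 * s))) \<le> ennreal (C * (\<bar>trial N x\<bar>\<^sup>2 / bdist a b x powr (2 * s)))"
        by (intro ennreal_leI) (simp add: mult_ac)
      also have "\<dots> = ennreal C * ennreal (\<bar>trial N x\<bar>\<^sup>2 / bdist a b x powr (2 * s))"
        by (intro ennreal_mult) (auto simp: C_def)
      finally show ?thesis using x by simp
    qed simp
  qed
  also have "\<dots> = ennreal C * hardy_integral s a b (trial N)"
    unfolding hardy_integral_def nn_integral_completion by (rule nn_integral_cmult) measurable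
  finally show ?thesis unfolding C_def .
qed

lemma gagliardo_sq_scale:
  assumes [measurable]: "u \<in> borel_measurable borel"
  shows "(gagliardo s (\<lambda>x. c * u x))\<^sup>2 = ennreal (c\<^sup>2) * (gagliardo s u)\<^sup>2"
proof -
  have "(gagliardo s (\<lambda>x. c * u x))\<^sup>2 = (\<integral>\<^sup>+z. ennreal (c\<^sup>2) * gagliardo_quotient u z \<partial>(lborel \<Otimes>\<^sub>M lborel))"
    unfolding gagliardo_sq
  proof (rule nn_integral_cong)
    fix z :: "real \<times> real"
    have "(c * u (fst z) - c * u (snd z))\<^sup>2 * ker (fst z) (snd z) = c\<^sup>2 * ((u (fst z) - u (snd z))\<^sup>2 * ker (fst z) (snd z))"
      by (simp add: right_diff_distrib[symmetric] power_mult_distrib)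
    then show "gagliardo_quotient (\<lambda>x. c * u x) z = ennreal (c\<^sup>2) * gagliardo_quotient u z"
      by (simp only: gagliardo_quotient_def) (intro ennreal_mult, auto)
  qed
  also have "\<dots> = ennreal (c\<^sup>2) * (gagliardo s u)\<^sup>2"
    unfolding gagliardo_sq by (rule nn_integral_cmult) measurable
  finally show ?thesis .
qed

lemma hardy_integral_scale:
  assumes [measurable]: "u \<in> borel_measurable borel"
  shows "hardy_integral s a b (\<lambda>x. c * u x) = ennreal (c\<^sup>2) * hardy_integral s a b u"
proof -
  have [measurable]: "bdist a b \<in> borel_measurable borel" unfolding bdist_def[abs_def] by measurable
  have "hardy_integral s a b (\<lambda>x. c * u x) = (\<integral>\<^sup>+x. ennreal (c\<^sup>2) * (ennreal (\<bar>u x\<bar>\<^sup>2 / bdist a b x powr (2 * s)) * indicator {a<..<b} x) \<partial>lborel)"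
    unfolding hardy_integral_def nn_integral_completion
  proof (rule nn_integral_cong)
    fix x
    have "\<bar>c * u x\<bar>\<^sup>2 / bdist a b x powr (2 * s) = c\<^sup>2 * (\<bar>u x\<bar>\<^sup>2 / bdist a b x powr (2 * s))"
      by (simp add: power_mult_distrib)
    then have "ennreal (\<bar>c * u x\<bar>\<^sup>2 / bdist a b x powr (2 * s)) = ennreal (c\<^sup>2) * ennreal (\<bar>u x\<bar>\<^sup>2 / bdist a b x powr (2 * s))"
      by (simp only:) (intro ennreal_mult, auto)
    then show "ennreal (\<bar>c * u x\<bar>\<^sup>2 / bdist a b x powr (2 * s)) * indicator {a<..<b} x =
       ennreal (c\<^sup>2) * (ennreal (\<bar>u x\<bar>\<^sup>2 / bdist a b x powr (2 * s)) * indicator {a<..<b} x)"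
      by (simp only: mult.assoc)
  qed
  also have "\<dots> = ennreal (c\<^sup>2) * hardy_integral s a b u"
    unfolding hardy_integral_def nn_integral_completion by (rule nn_integral_cmult) measurable
  finally show ?thesis .
qed

text \<open>The trial function, normalized to have Hardy integral 1, has the energy \<open>Lambda s\<close> up to a relative
  error of order \<open>1 / N\<^sup>2\<close> from the remainder and a factor from the comparison of the two weights.\<close>

lemma hardy_const_le_trial:
  assumes N: "0 < N"
  shows "hardy_const s a b \<le> ennreal ((1 + exp (- N)) powr (2 * s)
      * (Lambda s + 128 * exp 16 * enn2real (mellin (\<lambda>t. ennreal ((ln t)\<^sup>2))) / N\<^sup>2))"
proof -
  define j where "j = enn2real (mellin (\<lambda>t. ennreal ((ln t)\<^sup>2)))"
  have j: "mellin (\<lambda>t. ennreal ((ln t)\<^sup>2)) = ennreal j" "j \<ge> 0"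
    using mellin_ln_sq_finite by (auto simp: j_def less_top)
  define C where "C = (1 + exp (- N)) powr (2 * s)"
  have C: "C > 0" unfolding C_def using one_plus_exp_pos[of "- N"] by simp
  have test: "trial N \<in> test_functions a b" using test_functions_trial[OF N, of 1] by simp
  note td = test_functionD[OF test]
  obtain m where m: "conformal_mass (trial N) = ennreal m" "m \<ge> 0"
    using td(3) by (cases "conformal_mass (trial N)") auto
  have m_ge: "exp (- 16) * (N / 2) \<le> m" using conformal_mass_trial_ge[OF N] m by simp
  have m0: "m > 0" by (rule less_le_trans[OF _ m_ge]) (use N in simp)
  have "hardy_integral s a b (trial N) \<le> ennreal m" using hardy_integral_le_conformal_mass[of "trial N"] m by simp
  then obtain h where h: "hardy_integral s a b (trial N) = ennreal h" "h \<ge> 0"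
    by (cases "hardy_integral s a b (trial N)") (auto simp: top_unique)
  have "ennreal m \<le> ennreal (C * h)"
    using hardy_integral_trial_ge[OF N] C h by (simp add: m C_def[symmetric] ennreal_mult)
  then have mh: "m \<le> C * h" using h C by (subst (asm) ennreal_le_iff) auto
  then have h0: "h > 0" using m0 C h by (metis less_le_trans mult_zero_right order_le_less)
  define c where "c = 1 / sqrt h"
  have c2: "c\<^sup>2 = 1 / h" using h0 by (simp add: c_def power_divide)
  have "hardy_integral s a b (\<lambda>x. c * trial N x) = 1"
    using h0 by (simp add: hardy_integral_scale h c2 ennreal_mult[symmetric])
  then have "hardy_const s a b \<le> (gagliardo s (\<lambda>x. c * trial N x))\<^sup>2"
    unfolding hardy_const_def using test_functions_trial[OF N, of c] by (intro Inf_lower) auto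
  also have "\<dots> = ennreal (1 / h) * (gagliardo s (trial N))\<^sup>2"
    unfolding c2[symmetric] by (rule gagliardo_sq_scale) measurable
  also have "(gagliardo s (trial N))\<^sup>2 \<le> ennreal (64 / N) * ennreal j + ennreal (Lambda s) * ennreal m"
    using ground_state_representation[of "trial N"] td ground_energy_trial_le[OF N] by (simp add: m j)
  then have "ennreal (1 / h) * (gagliardo s (trial N))\<^sup>2 \<le> ennreal (1 / h) * (ennreal (64 / N) * ennreal j + ennreal (Lambda s) * ennreal m)"
    by (rule mult_left_mono) simp
  also have "ennreal (64 / N) * ennreal j + ennreal (Lambda s) * ennreal m = ennreal (64 / N * j + Lambda s * m)"
    using N j m Lambda_pos by (intro ennreal_linear_combination[symmetric]) auto
  also have "ennreal (1 / h) * ennreal (64 / N * j + Lambda s * m) = ennreal (1 / h * (64 / N * j + Lambda s * m))"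
    using h0 N j m Lambda_pos by (intro ennreal_mult[symmetric]) auto
  also have "\<dots> \<le> ennreal (C * (Lambda s + 128 * exp 16 * j / N\<^sup>2))"
  proof (rule ennreal_leI)
    have "1 / h \<le> C / m" using mh h0 m0 by (simp add: field_simps)
    then have "1 / h * (64 / N * j + Lambda s * m) \<le> C / m * (64 / N * j + Lambda s * m)"
      using N j m Lambda_pos by (intro mult_right_mono) auto
    also have "\<dots> = C * (Lambda s + 64 / N * j * (1 / m))" using m0 by (simp add: field_simps)
    also have "\<dots> \<le> C * (Lambda s + 64 / N * j * (2 * exp 16 / N))"
    proof -
      have "1 / m \<le> 1 / (exp (- 16) * (N / 2))" using m_ge N m0 by (intro divide_left_mono mult_pos_pos) auto
      also have "\<dots> = 2 * exp 16 / N" by (simp add: exp_minus field_simps)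
      finally show ?thesis using C N j by (intro mult_left_mono add_left_mono) auto
    qed
    also have "64 / N * j * (2 * exp 16 / N) = 128 * exp 16 * j / N\<^sup>2" by (simp add: power2_eq_square)
    finally show "1 / h * (64 / N * j + Lambda s * m) \<le> C * (Lambda s + 128 * exp 16 * j / N\<^sup>2)" .
  qed
  finally show ?thesis unfolding C_def j_def .
qed

lemma hardy_const_eq: "hardy_const s a b = ennreal (Lambda s)"
proof (rule antisym)
  define j where "j = enn2real (mellin (\<lambda>t. ennreal ((ln t)\<^sup>2)))"
  show "hardy_const s a b \<le> ennreal (Lambda s)"
  proof (rule LIMSEQ_le_const)
    have inv: "(\<lambda>n. 1 / real (Suc n)) \<longlonglongrightarrow> 0"
      using LIMSEQ_inverse_real_of_nat by (simp add: inverse_eq_divide)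
    have e: "(\<lambda>n. exp (- real (Suc n))) \<longlonglongrightarrow> 0"
      by (rule filterlim_compose[OF exp_at_bot])
        (intro filterlim_compose[OF filterlim_uminus_at_bot_at_top] filterlim_compose[OF filterlim_real_sequentially filterlim_Suc])
    have "(\<lambda>n. (1 + exp (- real (Suc n))) powr (2 * s) * (Lambda s + 128 * exp 16 * j * (1 / real (Suc n))\<^sup>2))
       \<longlonglongrightarrow> (1 + 0) powr (2 * s) * (Lambda s + 128 * exp 16 * j * 0\<^sup>2)"
      by (intro tendsto_intros e inv) auto
    then show "(\<lambda>n. ennreal ((1 + exp (- real (Suc n))) powr (2 * s) * (Lambda s + 128 * exp 16 * j * (1 / real (Suc n))\<^sup>2)))
       \<longlonglongrightarrow> ennreal (Lambda s)"
      by (intro tendsto_ennrealI) simp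
    show "\<exists>N. \<forall>n\<ge>N. hardy_const s a b \<le> ennreal ((1 + exp (- real (Suc n))) powr (2 * s) * (Lambda s + 128 * exp 16 * j * (1 / real (Suc n))\<^sup>2))"
      using hardy_const_le_trial[of "real (Suc _)"] unfolding j_def by (simp add: power_divide)
  qed
  show "ennreal (Lambda s) \<le> hardy_const s a b"
    unfolding hardy_const_def
  proof (rule Inf_greatest, clarify)
    fix u assume u: "u \<in> test_functions a b" "hardy_integral s a b u = 1"
    have "ennreal (Lambda s) * 1 \<le> ennreal (Lambda s) * conformal_mass u"
      using hardy_integral_le_conformal_mass[of u] u by (intro mult_left_mono) auto
    also have "\<dots> \<le> (gagliardo s u)\<^sup>2" by (rule hardy_test_function[OF u(1)])
    finally show "ennreal (Lambda s) \<le> (gagliardo s u)\<^sup>2" by simp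
  qed
qed

end

theorem proposition6p5:
  fixes s a b :: real
  assumes "0 < s" and "s < 1" and "a < b"
  shows "(\<forall>u \<in> W_tilde s a b.
            ennreal (Lambda s) *
              (\<integral>\<^sup>+ t\<in>{a<..<b}.
                 ennreal (\<bar>u t\<bar>\<^sup>2 * (1 / (t - a) + 1 / (b - t)) powr (2 * s)) \<partial>lebesgue)
            \<le> (gagliardo s u)\<^sup>2) \<and>
         hardy_const s a b = ennreal (Lambda s) \<and>
         \<not> (\<exists>u \<in> W_tilde s a b.
              hardy_integral s a b u = 1 \<and> (gagliardo s u)\<^sup>2 = hardy_const s a b)"
proof -
  interpret hardy_interval s a b by unfold_locales (fact assms)+
  show ?thesis
    unfolding conformal_mass_eq hardy_const_eq using hardy_W_tilde hardy_strict by blast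
qed

end
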